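(* Let $R$ be a Noetherian ring, let $I\subset R$ be an ideal, and let $a\in I$ be a regular element (nonzerodivisor) of $R$. Then $I$ is of linear type if and only if the natural surjection $\mathcal{S}_{R/(a)}(I/(a))\twoheadrightarrow \mathcal{A}_{R\twoheadrightarrow R/(a)}(I/(a))$ is an isomorphism.
   Context: Rings are commutative with $1$. $\mathcal{S}_R(M)$ denotes the symmetric algebra of an $R$-module $M$, and $\mathcal{R}_R(I)=\bigoplus_{t\ge 0}I^tu^t\subset R[u]$ the Rees algebra of an ideal $I$. An ideal $I\subset R$ is of linear type if the natural surjection $\mathcal{S}_R(I)\twoheadrightarrow\mathcal{R}_R(I)$ is an isomorphism. For ideals $J\subset I\subset R$, the ($R$-embedded) Aluffi algebra of $I/J$ is $$\mathcal{A}_{R\twoheadrightarrow R/J}(I/J):=\mathcal{S}_{R/J}(I/J)\otimes_{\mathcal{S}_R(I)}\mathcal{R}_R(I),$$ where $\mathcal{S}_R(I)\to\mathcal{S}_{R/J}(I/J)$ and $\mathcal{S}_R(I)\to\mathcal{R}_R(I)$ are the natural surjections; it is naturally isomorphic to $\mathcal{R}_R(I)/(J,\widetilde J)\mathcal{R}_R(I)\simeq\bigoplus_{t\ge0}I^t/JI^{t-1}$ (degree-zero part $R/J$), where $J$ is placed in degree $0$ and $\widetilde J=Ju$ in degree $1$. There is a natural surjection $\mathcal{S}_{R/J}(I/J)\twoheadrightarrow\mathcal{A}_{R\twoheadrightarrow R/J}(I/J)$. *)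

theory Defs
  imports "HOL-Algebra.Algebra"
begin

section \<open>Monoid algebras\<close>

text \<open>The monoid algebra R[G] of finitely supported functions on G with values in R, under
  convolution.  Functions are required to vanish outside the carrier of G.\<close>

definition coeff_supp :: "('a, 'm) ring_scheme \<Rightarrow> ('g \<Rightarrow> 'a) \<Rightarrow> 'g set" where
  "coeff_supp R f = {x. f x \<noteq> \<zero>\<^bsub>R\<^esub>}"

definition monoid_algebra ::
  "('a, 'm) ring_scheme \<Rightarrow> ('g, 'n) monoid_scheme \<Rightarrow> ('g \<Rightarrow> 'a) ring" where
  "monoid_algebra R G = \<lparr>
     carrier = {f. f \<in> UNIV \<rightarrow> carrier R \<and> finite (coeff_supp R f) \<and> coeff_supp R f \<subseteq> carrier G},
     monoid.mult = (\<lambda>f h z. \<Oplus>\<^bsub>R\<^esub>p \<in> {p \<in> coeff_supp R f \<times> coeff_supp R h. fst p \<otimes>\<^bsub>G\<^esub> snd p = z}.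
                        f (fst p) \<otimes>\<^bsub>R\<^esub> h (snd p)),
     one = (\<lambda>z. if z = \<one>\<^bsub>G\<^esub> then \<one>\<^bsub>R\<^esub> else \<zero>\<^bsub>R\<^esub>),
     ring.zero = (\<lambda>z. \<zero>\<^bsub>R\<^esub>),
     add = (\<lambda>f h z. f z \<oplus>\<^bsub>R\<^esub> h z)\<rparr>"

definition single :: "('a, 'm) ring_scheme \<Rightarrow> 'g \<Rightarrow> 'a \<Rightarrow> 'g \<Rightarrow> 'a" where
  "single R x r = (\<lambda>z. if z = x then r else \<zero>\<^bsub>R\<^esub>)"


section \<open>Symmetric algebras\<close>

definition free_comm_monoid :: "'x set \<Rightarrow> 'x multiset monoid" where
  "free_comm_monoid V = \<lparr>carrier = {A. set_mset A \<subseteq> V}, monoid.mult = (+), one = {#}\<rparr>"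

text \<open>The polynomial ring over R with one variable X(m) for every element m of M; the multiset A
  stands for the monomial that is the product of all X(m) with m in A.\<close>

definition sym_poly ::
  "('a, 'm) ring_scheme \<Rightarrow> ('a, 'b, 'n) module_scheme \<Rightarrow> ('b multiset \<Rightarrow> 'a) ring" where
  "sym_poly R M = monoid_algebra R (free_comm_monoid (carrier M))"

text \<open>The ideal generated by all X(x + y) - X(x) - X(y) and X(r x) - r X(x).\<close>

definition sym_ideal ::
  "('a, 'm) ring_scheme \<Rightarrow> ('a, 'b, 'n) module_scheme \<Rightarrow> ('b multiset \<Rightarrow> 'a) set" where
  "sym_ideal R M = Idl\<^bsub>sym_poly R M\<^esub>
     ({single R {#x \<oplus>\<^bsub>M\<^esub> y#} \<one>\<^bsub>R\<^esub> \<ominus>\<^bsub>sym_poly R M\<^esub> single R {#x#} \<one>\<^bsub>R\<^esub>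
         \<ominus>\<^bsub>sym_poly R M\<^esub> single R {#y#} \<one>\<^bsub>R\<^esub> | x y. x \<in> carrier M \<and> y \<in> carrier M} \<union>
      {single R {#r \<odot>\<^bsub>M\<^esub> x#} \<one>\<^bsub>R\<^esub> \<ominus>\<^bsub>sym_poly R M\<^esub> single R {#x#} r
         | r x. r \<in> carrier R \<and> x \<in> carrier M})"

definition sym_algebra ::
  "('a, 'm) ring_scheme \<Rightarrow> ('a, 'b, 'n) module_scheme \<Rightarrow> ('b multiset \<Rightarrow> 'a) set ring" where
  "sym_algebra R M = sym_poly R M Quot sym_ideal R M"

text \<open>The structure map from R and the canonical map from M (the inclusion of the degree 1 part).\<close>

definition sym_const ::
  "('a, 'm) ring_scheme \<Rightarrow> ('a, 'b, 'n) module_scheme \<Rightarrow> 'a \<Rightarrow> ('b multiset \<Rightarrow> 'a) set" where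
  "sym_const R M r = sym_ideal R M +>\<^bsub>sym_poly R M\<^esub> single R {#} r"

definition sym_gen ::
  "('a, 'm) ring_scheme \<Rightarrow> ('a, 'b, 'n) module_scheme \<Rightarrow> 'b \<Rightarrow> ('b multiset \<Rightarrow> 'a) set" where
  "sym_gen R M x = sym_ideal R M +>\<^bsub>sym_poly R M\<^esub> single R {#x#} \<one>\<^bsub>R\<^esub>"

text \<open>Evaluation of a polynomial, applying h to the coefficients and substituting \<phi>(m) for X(m).\<close>

definition poly_lift ::
  "('a, 'm) ring_scheme \<Rightarrow> ('c, 'n) ring_scheme \<Rightarrow> ('a \<Rightarrow> 'c) \<Rightarrow> ('b \<Rightarrow> 'c) \<Rightarrow>
     ('b multiset \<Rightarrow> 'a) \<Rightarrow> 'c" where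
  "poly_lift R B h \<phi> f =
     (\<Oplus>\<^bsub>B\<^esub>A \<in> coeff_supp R f. h (f A) \<otimes>\<^bsub>B\<^esub> (\<Otimes>\<^bsub>B\<^esub>x \<in> set_mset A. \<phi> x [^]\<^bsub>B\<^esub> count A x))"

text \<open>The ring homomorphism from the symmetric algebra of an R-module to a commutative ring B given
  by the universal property, for a ring homomorphism h from R to B and a map \<phi> from the module to B
  which is R-linear via h.\<close>

definition sym_lift ::
  "('a, 'm) ring_scheme \<Rightarrow> ('c, 'n) ring_scheme \<Rightarrow> ('a \<Rightarrow> 'c) \<Rightarrow> ('b \<Rightarrow> 'c) \<Rightarrow>
     ('b multiset \<Rightarrow> 'a) set \<Rightarrow> 'c" where
  "sym_lift R B h \<phi> P = the_elem (poly_lift R B h \<phi> ` P)"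


section \<open>Rees algebras and ideals of linear type\<close>

text \<open>An ideal as a module; the mult and one fields play no role in a module.\<close>

definition ideal_module :: "('a, 'm) ring_scheme \<Rightarrow> 'a set \<Rightarrow> ('a, 'a) module" where
  "ideal_module R I = \<lparr>carrier = I, monoid.mult = monoid.mult R, one = one R, ring.zero = ring.zero R, add = add R,
                        module.smult = monoid.mult R\<rparr>"

definition rees_algebra :: "('a, 'm) ring_scheme \<Rightarrow> 'a set \<Rightarrow> ('a, nat \<Rightarrow> 'a) up_ring" where
  "rees_algebra R I = (UP R)\<lparr>carrier :=
     {p \<in> carrier (UP R). \<forall>t. up_ring.coeff (UP R) p t \<in> I [^]\<^bsub>ideals_set R\<^esub> t}\<rparr>"

definition sym_to_rees ::
  "('a, 'm) ring_scheme \<Rightarrow> 'a set \<Rightarrow> ('a multiset \<Rightarrow> 'a) set \<Rightarrow> nat \<Rightarrow> 'a" where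
  "sym_to_rees R I =
     sym_lift R (rees_algebra R I) (\<lambda>r. up_ring.monom (UP R) r 0) (\<lambda>x. up_ring.monom (UP R) x 1)"

definition linear_type :: "('a, 'm) ring_scheme \<Rightarrow> 'a set \<Rightarrow> bool" where
  "linear_type R I \<longleftrightarrow>
     sym_to_rees R I \<in> ring_iso (sym_algebra R (ideal_module R I)) (rees_algebra R I)"


section \<open>Tensor products of commutative algebras\<close>

text \<open>For f from A to B and g from A to C, the tensor product of B and C over A is the quotient of
  the free abelian group on B \<times> C by the usual bilinearity and balancing relations.  With the product
  (b,c)(b',c') = (bb',cc') that group is the integral monoid ring of the multiplicative monoid
  B \<times> C, and the subgroup generated by the relations is the ideal generated by them, as the set of
  relations is stable under multiplication by pairs.\<close>

definition tensor_free ::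
  "('b, 'm) ring_scheme \<Rightarrow> ('c, 'n) ring_scheme \<Rightarrow> ('b \<times> 'c \<Rightarrow> int) ring" where
  "tensor_free B C = monoid_algebra \<Z> (B \<times>\<times> C)"

definition tensor_ideal ::
  "('a, 'k) ring_scheme \<Rightarrow> ('b, 'm) ring_scheme \<Rightarrow> ('c, 'n) ring_scheme \<Rightarrow>
     ('a \<Rightarrow> 'b) \<Rightarrow> ('a \<Rightarrow> 'c) \<Rightarrow> ('b \<times> 'c \<Rightarrow> int) set" where
  "tensor_ideal A B C f g = Idl\<^bsub>tensor_free B C\<^esub>
     ({single \<Z> (b \<oplus>\<^bsub>B\<^esub> b', c) 1 \<ominus>\<^bsub>tensor_free B C\<^esub> single \<Z> (b, c) 1
         \<ominus>\<^bsub>tensor_free B C\<^esub> single \<Z> (b', c) 1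
         | b b' c. b \<in> carrier B \<and> b' \<in> carrier B \<and> c \<in> carrier C} \<union>
      {single \<Z> (b, c \<oplus>\<^bsub>C\<^esub> c') 1 \<ominus>\<^bsub>tensor_free B C\<^esub> single \<Z> (b, c) 1
         \<ominus>\<^bsub>tensor_free B C\<^esub> single \<Z> (b, c') 1
         | b c c'. b \<in> carrier B \<and> c \<in> carrier C \<and> c' \<in> carrier C} \<union>
      {single \<Z> (f a \<otimes>\<^bsub>B\<^esub> b, c) 1 \<ominus>\<^bsub>tensor_free B C\<^esub> single \<Z> (b, g a \<otimes>\<^bsub>C\<^esub> c) 1
         | a b c. a \<in> carrier A \<and> b \<in> carrier B \<and> c \<in> carrier C})"

definition tensor_algebra ::
  "('a, 'k) ring_scheme \<Rightarrow> ('b, 'm) ring_scheme \<Rightarrow> ('c, 'n) ring_scheme \<Rightarrow>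
     ('a \<Rightarrow> 'b) \<Rightarrow> ('a \<Rightarrow> 'c) \<Rightarrow> ('b \<times> 'c \<Rightarrow> int) set ring" where
  "tensor_algebra A B C f g = tensor_free B C Quot tensor_ideal A B C f g"

definition pure_tensor ::
  "('a, 'k) ring_scheme \<Rightarrow> ('b, 'm) ring_scheme \<Rightarrow> ('c, 'n) ring_scheme \<Rightarrow>
     ('a \<Rightarrow> 'b) \<Rightarrow> ('a \<Rightarrow> 'c) \<Rightarrow> 'b \<Rightarrow> 'c \<Rightarrow> ('b \<times> 'c \<Rightarrow> int) set" where
  "pure_tensor A B C f g b c =
     tensor_ideal A B C f g +>\<^bsub>tensor_free B C\<^esub> single \<Z> (b, c) 1"


section \<open>Embedded Aluffi algebras\<close>

text \<open>The symmetric algebra of the R/J-module I/J.  The latter is the image of I in R/J, an ideal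
  of R/J.\<close>

definition quot_module :: "('a, 'm) ring_scheme \<Rightarrow> 'a set \<Rightarrow> 'a set \<Rightarrow> ('a set, 'a set) module" where
  "quot_module R I J = ideal_module (R Quot J) ((\<lambda>x. J +>\<^bsub>R\<^esub> x) ` I)"

definition sym_quot ::
  "('a, 'm) ring_scheme \<Rightarrow> 'a set \<Rightarrow> 'a set \<Rightarrow> ('a set multiset \<Rightarrow> 'a set) set ring" where
  "sym_quot R I J = sym_algebra (R Quot J) (quot_module R I J)"

definition sym_to_sym_quot ::
  "('a, 'm) ring_scheme \<Rightarrow> 'a set \<Rightarrow> 'a set \<Rightarrow>
     ('a multiset \<Rightarrow> 'a) set \<Rightarrow> ('a set multiset \<Rightarrow> 'a set) set" where
  "sym_to_sym_quot R I J = sym_lift R (sym_quot R I J)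
     (\<lambda>r. sym_const (R Quot J) (quot_module R I J) (J +>\<^bsub>R\<^esub> r))
     (\<lambda>x. sym_gen (R Quot J) (quot_module R I J) (J +>\<^bsub>R\<^esub> x))"

definition aluffi_algebra ::
  "('a, 'm) ring_scheme \<Rightarrow> 'a set \<Rightarrow> 'a set \<Rightarrow>
     ((('a set multiset \<Rightarrow> 'a set) set \<times> (nat \<Rightarrow> 'a)) \<Rightarrow> int) set ring" where
  "aluffi_algebra R I J =
     tensor_algebra (sym_algebra R (ideal_module R I)) (sym_quot R I J) (rees_algebra R I)
       (sym_to_sym_quot R I J) (sym_to_rees R I)"

text \<open>The natural surjection, sending b to the pure tensor of b and 1.\<close>

definition sym_quot_to_aluffi ::
  "('a, 'm) ring_scheme \<Rightarrow> 'a set \<Rightarrow> 'a set \<Rightarrow>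
     ('a set multiset \<Rightarrow> 'a set) set \<Rightarrow>
     ((('a set multiset \<Rightarrow> 'a set) set \<times> (nat \<Rightarrow> 'a)) \<Rightarrow> int) set" where
  "sym_quot_to_aluffi R I J b =
     pure_tensor (sym_algebra R (ideal_module R I)) (sym_quot R I J) (rees_algebra R I)
       (sym_to_sym_quot R I J) (sym_to_rees R I) b \<one>\<^bsub>rees_algebra R I\<^esub>"


section \<open>Regular elements\<close>

definition regular_element :: "('a, 'm) ring_scheme \<Rightarrow> 'a \<Rightarrow> bool" where
  "regular_element R a \<longleftrightarrow>
     a \<in> carrier R \<and> (\<forall>x \<in> carrier R. a \<otimes>\<^bsub>R\<^esub> x = \<zero>\<^bsub>R\<^esub> \<longrightarrow> x = \<zero>\<^bsub>R\<^esub>)"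

end

theory Submission
  imports Defs
begin

text \<open>Let \<open>K\<close> be the kernel of the surjection from the symmetric algebra \<open>S\<close> of \<open>I\<close> to the Rees algebra.
  The kernel of the map from \<open>S\<close> to the symmetric algebra of \<open>I/(a)\<close> is \<open>(a, X(a))\<close>, so the surjection
  to the Aluffi algebra is injective iff \<open>K \<subseteq> (a, X(a))\<close>.  In that case \<open>K = 0\<close> by induction
  on the degree: write a homogeneous \<open>f \<in> K\<close> of degree \<open>t + 1\<close> as \<open>f = a g + X(a) h\<close>.  Since
  \<open>a X(x) = X(a x) = x X(a)\<close>, the term \<open>a g\<close> is also a multiple of \<open>X(a)\<close>, so \<open>f = X(a) e\<close> with \<open>e\<close>
  homogeneous of degree \<open>t\<close>.  As \<open>a\<close> is regular, \<open>X(a)\<close> becomes a nonzerodivisor in \<open>R[u]\<close>, so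
  \<open>e \<in> K\<close>, and \<open>e = 0\<close> by induction.\<close>

section \<open>Monoid algebras\<close>

text \<open>The inclusion of K in (a, X(a)) comes from the balancing relation. For z in K, the image
  of z in the symmetric algebra of I/(a), tensored with 1, equals 1 tensored with the image of z in
  the Rees algebra, which is 0; injectivity then kills the first image. The converse is base change:
  if the map from S to the Rees algebra is an isomorphism, tensoring along it changes nothing. The
  induction needs degrees, but S is only given as a quotient ring. So the grading lives on the
  polynomial ring, where degree counts variables, and the ideal of relations is shown to be
  homogeneous; elements of S are handled as polynomials modulo that ideal. Degree 0 offers no
  variable to trade against a, but there the map to R[u] merely embeds the constants. Both the
  polynomial ring and the free group behind the tensor product are monoid algebras, so a single
  construction of homomorphisms serves for evaluating polynomials and for the retraction of the
  tensor product.\<close>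

locale monoid_algebra_over = cring R + G: comm_monoid G for R (structure) and G (structure)
begin

abbreviation MA where "MA \<equiv> monoid_algebra R G"

lemma MA_carrier_iff:
  "f \<in> carrier MA \<longleftrightarrow>
    (\<forall>x. f x \<in> carrier R) \<and> finite (coeff_supp R f) \<and> coeff_supp R f \<subseteq> carrier G"
  by (auto simp: monoid_algebra_def)

lemma MA_apply_closed: "f \<in> carrier MA \<Longrightarrow> f x \<in> carrier R"
  by (simp add: MA_carrier_iff)

lemma MA_add_apply: "(f \<oplus>\<^bsub>MA\<^esub> h) x = f x \<oplus> h x"
  by (simp add: monoid_algebra_def)

lemma MA_zero_apply: "\<zero>\<^bsub>MA\<^esub> x = \<zero>"
  by (simp add: monoid_algebra_def)

lemmas MA_apply = MA_add_apply MA_zero_apply MA_apply_closed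

lemma MA_one_eq: "\<one>\<^bsub>MA\<^esub> = single R \<one>\<^bsub>G\<^esub> \<one>"
  by (simp add: monoid_algebra_def single_def)

lemma single_zero [simp]: "single R x \<zero> = \<zero>\<^bsub>MA\<^esub>"
  by (auto simp: monoid_algebra_def single_def)

lemma coeff_supp_single: "coeff_supp R (single R x r) \<subseteq> {x}"
  by (auto simp: coeff_supp_def single_def)

lemma single_closed [simp]:
  "x \<in> carrier G \<Longrightarrow> r \<in> carrier R \<Longrightarrow> single R x r \<in> carrier MA"
  using coeff_supp_single[of x r] finite_subset[OF coeff_supp_single[of x r]]
  by (auto simp: MA_carrier_iff single_def)

lemma single_add:
  "r \<in> carrier R \<Longrightarrow> s \<in> carrier R \<Longrightarrow>
    single R x (r \<oplus> s) = single R x r \<oplus>\<^bsub>MA\<^esub> single R x s"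
  by (auto simp: single_def MA_apply)

lemma MA_add_closed: "f \<in> carrier MA \<Longrightarrow> h \<in> carrier MA \<Longrightarrow> f \<oplus>\<^bsub>MA\<^esub> h \<in> carrier MA"
proof -
  assume f: "f \<in> carrier MA" and h: "h \<in> carrier MA"
  have "coeff_supp R (f \<oplus>\<^bsub>MA\<^esub> h) \<subseteq> coeff_supp R f \<union> coeff_supp R h"
    by (auto simp: coeff_supp_def MA_apply)
  with f h show ?thesis
    by (auto simp: MA_carrier_iff MA_add_apply intro: finite_subset)
qed

lemma MA_zero_closed: "\<zero>\<^bsub>MA\<^esub> \<in> carrier MA"
  by (simp add: MA_carrier_iff coeff_supp_def MA_zero_apply)

lemma MA_abelian_group: "abelian_group MA"
proof (rule abelian_groupI)
  fix f assume f: "f \<in> carrier MA"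
  define h where "h = (\<lambda>x. \<ominus> f x)"
  have "coeff_supp R h = coeff_supp R f"
    using f by (auto simp: h_def coeff_supp_def MA_carrier_iff)
  then have "h \<in> carrier MA"
    using f by (auto simp: MA_carrier_iff h_def)
  moreover have "h \<oplus>\<^bsub>MA\<^esub> f = \<zero>\<^bsub>MA\<^esub>"
    using f by (auto simp: h_def l_neg MA_apply)
  ultimately show "\<exists>h\<in>carrier MA. h \<oplus>\<^bsub>MA\<^esub> f = \<zero>\<^bsub>MA\<^esub>"
    by blast
qed (auto simp: MA_add_closed MA_zero_closed MA_apply a_ac intro!: ext)

text \<open>Pairs outside the supports contribute zero products. Allowing any finite supersets lets
  products of functions with different supports be compared over one index set, as distributivity
  requires.\<close>

lemma MA_mult_apply:
  assumes f: "f \<in> carrier MA" and h: "h \<in> carrier MA"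
    and U: "finite U" "coeff_supp R f \<subseteq> U" and V: "finite V" "coeff_supp R h \<subseteq> V"
  shows "(f \<otimes>\<^bsub>MA\<^esub> h) z =
    (\<Oplus>p \<in> {p \<in> U \<times> V. fst p \<otimes>\<^bsub>G\<^esub> snd p = z}. f (fst p) \<otimes> h (snd p))"
proof -
  let ?S = "{p \<in> coeff_supp R f \<times> coeff_supp R h. fst p \<otimes>\<^bsub>G\<^esub> snd p = z}"
  let ?T = "{p \<in> U \<times> V. fst p \<otimes>\<^bsub>G\<^esub> snd p = z}"
  have "(\<Oplus>p \<in> ?S. f (fst p) \<otimes> h (snd p)) = (\<Oplus>p \<in> ?T. f (fst p) \<otimes> h (snd p))"
  proof (rule add.finprod_mono_neutral_cong_left)
    show "finite ?T" using U V by auto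
    show "?S \<subseteq> ?T" using U V by auto
    show "f (fst p) \<otimes> h (snd p) = \<zero>" if "p \<in> ?T - ?S" for p
      using that f h by (cases p) (auto simp: coeff_supp_def MA_apply)
  qed (use f h in \<open>auto simp: MA_apply\<close>)
  then show ?thesis
    by (simp add: monoid_algebra_def)
qed

lemma MA_mult_single:
  assumes "x \<in> carrier G" "y \<in> carrier G" "r \<in> carrier R" "s \<in> carrier R"
  shows "single R x r \<otimes>\<^bsub>MA\<^esub> single R y s = single R (x \<otimes>\<^bsub>G\<^esub> y) (r \<otimes> s)"
proof
  fix z
  have "(single R x r \<otimes>\<^bsub>MA\<^esub> single R y s) z =
      (\<Oplus>p \<in> {p \<in> {x} \<times> {y}. fst p \<otimes>\<^bsub>G\<^esub> snd p = z}. single R x r (fst p) \<otimes> single R y s (snd p))"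
    using assms by (intro MA_mult_apply coeff_supp_single) auto
  also have "{p \<in> {x} \<times> {y}. fst p \<otimes>\<^bsub>G\<^esub> snd p = z} = (if x \<otimes>\<^bsub>G\<^esub> y = z then {(x, y)} else {})"
    by auto
  finally show "(single R x r \<otimes>\<^bsub>MA\<^esub> single R y s) z = single R (x \<otimes>\<^bsub>G\<^esub> y) (r \<otimes> s) z"
    using assms by (auto simp: single_def)
qed

lemma MA_mult_closed:
  assumes f: "f \<in> carrier MA" and h: "h \<in> carrier MA"
  shows "f \<otimes>\<^bsub>MA\<^esub> h \<in> carrier MA"
proof -
  let ?I = "(\<lambda>p. fst p \<otimes>\<^bsub>G\<^esub> snd p) ` (coeff_supp R f \<times> coeff_supp R h)"
  have ap: "(f \<otimes>\<^bsub>MA\<^esub> h) z =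
      (\<Oplus>p \<in> {p \<in> coeff_supp R f \<times> coeff_supp R h. fst p \<otimes>\<^bsub>G\<^esub> snd p = z}. f (fst p) \<otimes> h (snd p))" for z
    by (simp add: monoid_algebra_def)
  have "(f \<otimes>\<^bsub>MA\<^esub> h) z = \<zero>" if "z \<notin> ?I" for z
  proof -
    have "{p \<in> coeff_supp R f \<times> coeff_supp R h. fst p \<otimes>\<^bsub>G\<^esub> snd p = z} = {}"
      using that by blast
    then show ?thesis unfolding ap by (simp only: finsum_empty)
  qed
  then have "coeff_supp R (f \<otimes>\<^bsub>MA\<^esub> h) \<subseteq> ?I"
    by (auto simp: coeff_supp_def)
  moreover have "finite ?I" "?I \<subseteq> carrier G"
    using f h by (auto simp: MA_carrier_iff subset_iff)
  moreover have "(f \<otimes>\<^bsub>MA\<^esub> h) z \<in> carrier R" for z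
    unfolding ap using f h by (intro finsum_closed) (auto simp: MA_apply)
  ultimately show ?thesis
    by (auto simp: MA_carrier_iff intro: finite_subset)
qed

lemma MA_comm:
  assumes f: "f \<in> carrier MA" and h: "h \<in> carrier MA"
  shows "f \<otimes>\<^bsub>MA\<^esub> h = h \<otimes>\<^bsub>MA\<^esub> f"
proof
  fix z
  let ?S = "{p \<in> coeff_supp R f \<times> coeff_supp R h. fst p \<otimes>\<^bsub>G\<^esub> snd p = z}"
  \<comment> \<open>Commutativity of \<open>G\<close> makes swapping a bijection between the index
    sets of the two convolutions.\<close>
  have eq: "{p \<in> coeff_supp R h \<times> coeff_supp R f. fst p \<otimes>\<^bsub>G\<^esub> snd p = z} = prod.swap ` ?S"
    using f h by (auto simp: MA_carrier_iff image_iff G.m_comm subset_iff)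
  have "(h \<otimes>\<^bsub>MA\<^esub> f) z = (\<Oplus>p \<in> prod.swap ` ?S. h (fst p) \<otimes> f (snd p))"
    by (simp add: monoid_algebra_def flip: eq)
  also have "\<dots> = (\<Oplus>p \<in> ?S. h (fst (prod.swap p)) \<otimes> f (snd (prod.swap p)))"
    using f h by (intro finsum_reindex) (auto simp: inj_on_def MA_apply)
  also have "\<dots> = (\<Oplus>p \<in> ?S. f (fst p) \<otimes> h (snd p))"
    using f h by (intro finsum_cong) (auto simp: m_comm MA_apply)
  also have "\<dots> = (f \<otimes>\<^bsub>MA\<^esub> h) z"
    by (simp add: monoid_algebra_def)
  finally show "(f \<otimes>\<^bsub>MA\<^esub> h) z = (h \<otimes>\<^bsub>MA\<^esub> f) z" ..
qed

lemma MA_l_distr: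
  assumes f: "f \<in> carrier MA" and g: "g \<in> carrier MA" and h: "h \<in> carrier MA"
  shows "(f \<oplus>\<^bsub>MA\<^esub> g) \<otimes>\<^bsub>MA\<^esub> h = f \<otimes>\<^bsub>MA\<^esub> h \<oplus>\<^bsub>MA\<^esub> g \<otimes>\<^bsub>MA\<^esub> h"
proof
  fix z
  let ?U = "coeff_supp R f \<union> coeff_supp R g" and ?V = "coeff_supp R h"
  have fin: "finite ?U" "finite ?V" "coeff_supp R (f \<oplus>\<^bsub>MA\<^esub> g) \<subseteq> ?U"
    using f g h by (auto simp: MA_carrier_iff coeff_supp_def MA_add_apply)
  let ?S = "{p \<in> ?U \<times> ?V. fst p \<otimes>\<^bsub>G\<^esub> snd p = z}"
  have "((f \<oplus>\<^bsub>MA\<^esub> g) \<otimes>\<^bsub>MA\<^esub> h) z = (\<Oplus>p \<in> ?S. (f \<oplus>\<^bsub>MA\<^esub> g) (fst p) \<otimes> h (snd p))"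
    using fin f g h by (intro MA_mult_apply MA_add_closed) auto
  also have "\<dots> = (\<Oplus>p \<in> ?S. f (fst p) \<otimes> h (snd p) \<oplus> g (fst p) \<otimes> h (snd p))"
    using f g h by (intro finsum_cong) (auto simp: l_distr MA_apply)
  also have "\<dots> = (\<Oplus>p \<in> ?S. f (fst p) \<otimes> h (snd p)) \<oplus> (\<Oplus>p \<in> ?S. g (fst p) \<otimes> h (snd p))"
    using f g h by (intro finsum_addf) (auto simp: MA_apply)
  also have "(\<Oplus>p \<in> ?S. f (fst p) \<otimes> h (snd p)) = (f \<otimes>\<^bsub>MA\<^esub> h) z"
    using fin f g h by (intro MA_mult_apply[symmetric]) auto
  also have "(\<Oplus>p \<in> ?S. g (fst p) \<otimes> h (snd p)) = (g \<otimes>\<^bsub>MA\<^esub> h) z"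
    using fin f g h by (intro MA_mult_apply[symmetric]) auto
  finally show "((f \<oplus>\<^bsub>MA\<^esub> g) \<otimes>\<^bsub>MA\<^esub> h) z = (f \<otimes>\<^bsub>MA\<^esub> h \<oplus>\<^bsub>MA\<^esub> g \<otimes>\<^bsub>MA\<^esub> h) z"
    by (rule trans[OF _ MA_add_apply[symmetric]])
qed

text \<open>Elements are finite sums of functions supported at one point, so an additive identity
  need only be checked on \<open>single\<close>. The induction runs over a finite set containing the
  support.\<close>

lemma MA_induct [consumes 1, case_names zero add]:
  assumes f: "f \<in> carrier MA" and zero: "P \<zero>\<^bsub>MA\<^esub>"
    and add: "\<And>x r f. x \<in> carrier G \<Longrightarrow> r \<in> carrier R \<Longrightarrow> f \<in> carrier MA \<Longrightarrow> P f \<Longrightarrow>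
      P (single R x r \<oplus>\<^bsub>MA\<^esub> f)"
  shows "P f"
proof -
  have "\<lbrakk>f \<in> carrier MA; coeff_supp R f \<subseteq> U\<rbrakk> \<Longrightarrow> P f" if "finite U" for U
    using that
  proof (induction U arbitrary: f rule: finite_induct)
    case empty
    then have "f = \<zero>\<^bsub>MA\<^esub>"
      by (auto simp: coeff_supp_def MA_apply)
    then show ?case using zero by simp
  next
    case (insert x U)
    show ?case
    proof (cases "x \<in> carrier G")
      case True
      define f' where "f' = f(x := \<zero>)"
      have sub: "coeff_supp R f' \<subseteq> U" "coeff_supp R f' \<subseteq> coeff_supp R f"
        using insert.prems by (auto simp: f'_def coeff_supp_def)
      have f': "f' \<in> carrier MA"
        using insert.prems sub finite_subset[OF sub(2)] by (auto simp: MA_carrier_iff f'_def)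
      have "f = single R x (f x) \<oplus>\<^bsub>MA\<^esub> f'"
        using insert.prems by (auto simp: single_def f'_def MA_apply)
      then show ?thesis
        using add[OF True _ f', of "f x"] insert.IH[OF f' sub(1)] insert.prems by (simp add: MA_apply)
    next
      \<comment> \<open>The covering set may contain points outside \<open>G\<close>; f vanishes
        there, so the smaller set already covers the support.\<close>
      case False
      then have "coeff_supp R f \<subseteq> U"
        using insert.prems by (auto simp: MA_carrier_iff)
      then show ?thesis using insert by auto
    qed
  qed
  then show ?thesis using f by (auto simp: MA_carrier_iff)
qed

lemma MA_cring: "cring MA"
proof -
  interpret A: abelian_group MA by (rule MA_abelian_group)
  have r_distr: "h \<otimes>\<^bsub>MA\<^esub> (f \<oplus>\<^bsub>MA\<^esub> g) = h \<otimes>\<^bsub>MA\<^esub> f \<oplus>\<^bsub>MA\<^esub> h \<otimes>\<^bsub>MA\<^esub> g"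
    if "f \<in> carrier MA" "g \<in> carrier MA" "h \<in> carrier MA" for f g h
    using that by (metis MA_l_distr MA_comm MA_add_closed)
  have l_null: "\<zero>\<^bsub>MA\<^esub> \<otimes>\<^bsub>MA\<^esub> f = \<zero>\<^bsub>MA\<^esub>" for f
    by (auto simp: monoid_algebra_def coeff_supp_def)
  have r_null: "f \<otimes>\<^bsub>MA\<^esub> \<zero>\<^bsub>MA\<^esub> = \<zero>\<^bsub>MA\<^esub>" for f
    by (auto simp: monoid_algebra_def coeff_supp_def)
  have one: "\<one>\<^bsub>MA\<^esub> \<otimes>\<^bsub>MA\<^esub> f = f" if "f \<in> carrier MA" for f
    using that
  proof (induction rule: MA_induct)
    case (add x r f)
    then show ?case
      by (simp add: r_distr MA_one_eq MA_mult_single)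
  qed (simp add: r_null)
  \<comment> \<open>Associativity is trilinear: the last, the middle and the first factor are
    reduced to \<open>single\<close> in turn, leaving associativity in \<open>G\<close> and in
    \<open>R\<close>.\<close>
  have assoc1: "(single R x r \<otimes>\<^bsub>MA\<^esub> single R y s) \<otimes>\<^bsub>MA\<^esub> h = single R x r \<otimes>\<^bsub>MA\<^esub> (single R y s \<otimes>\<^bsub>MA\<^esub> h)"
    if "x \<in> carrier G" "r \<in> carrier R" "y \<in> carrier G" "s \<in> carrier R" "h \<in> carrier MA"
    for x r y s h
    using that(5)
  proof (induction rule: MA_induct)
    case (add z t h)
    then show ?case
      using that by (simp add: r_distr MA_mult_closed MA_mult_single G.m_assoc m_assoc)
  qed (simp add: r_null)
  have assoc2: "(single R x r \<otimes>\<^bsub>MA\<^esub> g) \<otimes>\<^bsub>MA\<^esub> h = single R x r \<otimes>\<^bsub>MA\<^esub> (g \<otimes>\<^bsub>MA\<^esub> h)"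
    if "x \<in> carrier G" "r \<in> carrier R" "g \<in> carrier MA" "h \<in> carrier MA" for x r g h
    using that(3)
  proof (induction rule: MA_induct)
    case (add z t g)
    then show ?case
      using that by (simp add: r_distr MA_l_distr MA_mult_closed assoc1)
  qed (simp add: l_null r_null)
  have assoc: "(f \<otimes>\<^bsub>MA\<^esub> g) \<otimes>\<^bsub>MA\<^esub> h = f \<otimes>\<^bsub>MA\<^esub> (g \<otimes>\<^bsub>MA\<^esub> h)"
    if "f \<in> carrier MA" "g \<in> carrier MA" "h \<in> carrier MA" for f g h
    using that(1)
  proof (induction rule: MA_induct)
    case (add z t f)
    then show ?case
      using that by (simp add: MA_l_distr MA_mult_closed assoc2)
  qed (simp add: l_null)
  show ?thesis
  proof (rule cringI[OF MA_abelian_group])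
    show "comm_monoid MA"
      by (rule comm_monoidI) (fact MA_mult_closed assoc one MA_comm | simp add: MA_one_eq)+
  qed (rule MA_l_distr)
qed

end

section \<open>Homomorphisms out of a monoid algebra\<close>

definition MA_lift where
  "MA_lift R B h \<psi> f = (\<Oplus>\<^bsub>B\<^esub>x \<in> coeff_supp R f. h (f x) \<otimes>\<^bsub>B\<^esub> \<psi> x)"

text \<open>The data of a homomorphism out of R[G]: a ring homomorphism on coefficients and a
  multiplicative map on \<open>G\<close>. It is used with monomials for \<open>G\<close>, giving
  polynomial evaluation, and with pairs from a product of rings, giving a map out of a tensor
  product.\<close>

locale monoid_algebra_lift = monoid_algebra_over R G + B: cring B
  for R (structure) and G (structure) and B (structure) +
  fixes h \<psi>
  assumes h: "h \<in> ring_hom R B"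
    and psi_closed [simp]: "x \<in> carrier G \<Longrightarrow> \<psi> x \<in> carrier B"
    and psi_one [simp]: "\<psi> \<one>\<^bsub>G\<^esub> = \<one>\<^bsub>B\<^esub>"
    and psi_mult [simp]: "x \<in> carrier G \<Longrightarrow> y \<in> carrier G \<Longrightarrow> \<psi> (x \<otimes>\<^bsub>G\<^esub> y) = \<psi> x \<otimes>\<^bsub>B\<^esub> \<psi> y"
begin

sublocale h: ring_hom_cring R B h
  by unfold_locales (rule h)

abbreviation lft where "lft \<equiv> MA_lift R B h \<psi>"

lemma lift_eq_sum:
  assumes f: "f \<in> carrier MA" and U: "finite U" "coeff_supp R f \<subseteq> U" "U \<subseteq> carrier G"
  shows "lft f = (\<Oplus>\<^bsub>B\<^esub>x \<in> U. h (f x) \<otimes>\<^bsub>B\<^esub> \<psi> x)"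
  unfolding MA_lift_def
  using U f by (intro B.add.finprod_mono_neutral_cong_left) (auto simp: coeff_supp_def subset_iff MA_apply)

lemma lift_single [simp]:
  assumes "x \<in> carrier G" "r \<in> carrier R"
  shows "lft (single R x r) = h r \<otimes>\<^bsub>B\<^esub> \<psi> x"
proof -
  have "lft (single R x r) = (\<Oplus>\<^bsub>B\<^esub>z \<in> {x}. h (single R x r z) \<otimes>\<^bsub>B\<^esub> \<psi> z)"
    using assms by (intro lift_eq_sum single_closed coeff_supp_single) auto
  then show ?thesis using assms by (simp add: single_def)
qed

lemma lift_closed [simp]: "f \<in> carrier MA \<Longrightarrow> lft f \<in> carrier B"
  unfolding MA_lift_def by (rule B.finsum_closed) (auto simp: MA_carrier_iff)

lemma lift_add:
  assumes f: "f \<in> carrier MA" and g: "g \<in> carrier MA"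
  shows "lft (f \<oplus>\<^bsub>MA\<^esub> g) = lft f \<oplus>\<^bsub>B\<^esub> lft g"
proof -
  let ?U = "coeff_supp R f \<union> coeff_supp R g"
  have U: "finite ?U" "coeff_supp R (f \<oplus>\<^bsub>MA\<^esub> g) \<subseteq> ?U" "?U \<subseteq> carrier G"
    using f g by (auto simp: MA_carrier_iff coeff_supp_def MA_add_apply)
  have "lft (f \<oplus>\<^bsub>MA\<^esub> g) = (\<Oplus>\<^bsub>B\<^esub>x \<in> ?U. h ((f \<oplus>\<^bsub>MA\<^esub> g) x) \<otimes>\<^bsub>B\<^esub> \<psi> x)"
    using f g U by (intro lift_eq_sum MA_add_closed)
  also have "\<dots> = (\<Oplus>\<^bsub>B\<^esub>x \<in> ?U. h (f x) \<otimes>\<^bsub>B\<^esub> \<psi> x \<oplus>\<^bsub>B\<^esub> h (g x) \<otimes>\<^bsub>B\<^esub> \<psi> x)"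
    using f g U by (intro B.finsum_cong'[OF refl]) (auto simp: B.l_distr MA_apply subset_iff)
  also have "\<dots> = (\<Oplus>\<^bsub>B\<^esub>x \<in> ?U. h (f x) \<otimes>\<^bsub>B\<^esub> \<psi> x) \<oplus>\<^bsub>B\<^esub> (\<Oplus>\<^bsub>B\<^esub>x \<in> ?U. h (g x) \<otimes>\<^bsub>B\<^esub> \<psi> x)"
    using f g U by (intro B.finsum_addf) (auto simp: MA_apply subset_iff)
  also have "(\<Oplus>\<^bsub>B\<^esub>x \<in> ?U. h (f x) \<otimes>\<^bsub>B\<^esub> \<psi> x) = lft f"
    using f g U by (intro lift_eq_sum[symmetric]) auto
  also have "(\<Oplus>\<^bsub>B\<^esub>x \<in> ?U. h (g x) \<otimes>\<^bsub>B\<^esub> \<psi> x) = lft g"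
    using f g U by (intro lift_eq_sum[symmetric]) auto
  finally show ?thesis .
qed

lemma lift_ring_hom: "lft \<in> ring_hom MA B"
proof (rule ring_hom_memI)
  interpret A: cring MA by (rule MA_cring)
  have zero: "lft \<zero>\<^bsub>MA\<^esub> = \<zero>\<^bsub>B\<^esub>"
    by (simp add: MA_lift_def coeff_supp_def MA_apply)
  \<comment> \<open>By additivity in each factor, multiplicativity reduces to two
    \<open>single\<close> functions, where it is \<open>psi_mult\<close> rearranged in the
    commutative ring \<open>B\<close>.\<close>
  have 1: "lft (single R x r \<otimes>\<^bsub>MA\<^esub> g) = lft (single R x r) \<otimes>\<^bsub>B\<^esub> lft g"
    if "x \<in> carrier G" "r \<in> carrier R" "g \<in> carrier MA" for x r g
    using that(3)
  proof (induction rule: MA_induct)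
    case (add z t g)
    have "h r \<otimes>\<^bsub>B\<^esub> h t \<otimes>\<^bsub>B\<^esub> (\<psi> x \<otimes>\<^bsub>B\<^esub> \<psi> z) = h r \<otimes>\<^bsub>B\<^esub> \<psi> x \<otimes>\<^bsub>B\<^esub> (h t \<otimes>\<^bsub>B\<^esub> \<psi> z)"
      using that add by (simp add: B.m_ac)
    then show ?case
      using that add by (simp add: A.r_distr lift_add MA_mult_single B.r_distr)
  qed (use that in \<open>simp add: zero\<close>)
  show "lft (f \<otimes>\<^bsub>MA\<^esub> g) = lft f \<otimes>\<^bsub>B\<^esub> lft g"
    if "f \<in> carrier MA" "g \<in> carrier MA" for f g
    using that(1)
  proof (induction rule: MA_induct)
    case (add z t f)
    then show ?case
      using that by (simp add: A.l_distr lift_add 1 B.l_distr)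
  qed (use that in \<open>simp add: zero\<close>)
  show "lft \<one>\<^bsub>MA\<^esub> = \<one>\<^bsub>B\<^esub>"
    by (simp add: MA_one_eq)
qed (simp_all add: lift_add)

end

section \<open>Quotient rings\<close>

lemma (in ideal) FactRing_carrier_cases:
  assumes "C \<in> carrier (R Quot I)"
  obtains x where "x \<in> carrier R" "C = I +> x"
  using assms by (auto simp: FactRing_simps)

lemma (in ideal) FactRing_coset_closed [simp]:
  "x \<in> carrier R \<Longrightarrow> I +> x \<in> carrier (R Quot I)"
  by (auto simp: FactRing_simps)

lemma (in ideal) coset_eq_iff:
  "x \<in> carrier R \<Longrightarrow> y \<in> carrier R \<Longrightarrow> I +> x = I +> y \<longleftrightarrow> x \<ominus> y \<in> I"
  using quotient_eq_iff_same_a_r_cos[OF is_ideal] by blast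

lemma (in ideal) coset_eq_zero_iff:
  "x \<in> carrier R \<Longrightarrow> I +> x = \<zero>\<^bsub>R Quot I\<^esub> \<longleftrightarrow> x \<in> I"
  using a_rcos_zero[OF is_ideal] rcos_const_imp_mem by (auto simp: FactRing_def)

text \<open>Since k kills \<open>L\<close>, it is constant on each coset, so the image of a coset is
  a singleton. This is what makes the \<open>the_elem\<close> in \<open>sym_lift\<close>
  meaningful.\<close>

lemma the_elem_coset:
  assumes "ideal L P" and k: "ring_hom_ring P B k" and ker: "\<And>x. x \<in> L \<Longrightarrow> k x = \<zero>\<^bsub>B\<^esub>"
    and f: "f \<in> carrier P"
  shows "the_elem (k ` (L +>\<^bsub>P\<^esub> f)) = k f"
proof -
  interpret L: ideal L P by fact
  interpret k: ring_hom_ring P B k by fact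
  have "k ` (L +>\<^bsub>P\<^esub> f) = {k f}"
  proof (intro equalityI subsetI)
    fix y assume "y \<in> k ` (L +>\<^bsub>P\<^esub> f)"
    then obtain l where "l \<in> L" "y = k (l \<oplus>\<^bsub>P\<^esub> f)"
      by (auto simp: a_r_coset_def')
    then show "y \<in> {k f}" using f by (simp add: ker)
  next
    fix y assume "y \<in> {k f}"
    then show "y \<in> k ` (L +>\<^bsub>P\<^esub> f)" using L.a_rcos_self[OF f] by auto
  qed
  then show ?thesis by simp
qed

lemma the_elem_ring_hom:
  assumes L: "ideal L P" and k: "ring_hom_ring P B k" and ker: "\<And>x. x \<in> L \<Longrightarrow> k x = \<zero>\<^bsub>B\<^esub>"
  shows "(\<lambda>F. the_elem (k ` F)) \<in> ring_hom (P Quot L) B"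
proof -
  interpret L: ideal L P by fact
  interpret k: ring_hom_ring P B k by fact
  note coset = the_elem_coset[OF L k ker]
  show ?thesis
    by (rule ring_hom_memI; (elim L.FactRing_carrier_cases)?)
       (simp_all add: coset FactRing_def L.rcoset_mult_add L.a_rcos_sum)
qed

lemma (in abelian_group_hom) hom_minus:
  "x \<in> carrier G \<Longrightarrow> y \<in> carrier G \<Longrightarrow> h (x \<ominus>\<^bsub>G\<^esub> y) = h x \<ominus>\<^bsub>H\<^esub> h y"
  by (simp add: G.minus_eq H.minus_eq)

lemma (in cring) add_minus_minus: "x \<in> carrier R \<Longrightarrow> y \<in> carrier R \<Longrightarrow> x \<oplus> y \<ominus> x \<ominus> y = \<zero>"
  by algebra

text \<open>Additivity relations, both for symmetric algebras and for tensors, are generated in the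
  form x - y - z; this turns them back into equations in the quotient.\<close>

lemma (in ring) minus_minus_eq_zeroD:
  assumes "x \<in> carrier R" "y \<in> carrier R" "z \<in> carrier R" and eq: "x \<ominus> y \<ominus> z = \<zero>"
  shows "x = y \<oplus> z"
proof -
  have "x = (x \<ominus> y \<ominus> z) \<oplus> (y \<oplus> z)"
    using assms(1-3) by algebra
  then show ?thesis
    using assms(1-3) by (simp add: eq)
qed

lemma (in ring) minus_eq_zeroD:
  assumes "x \<in> carrier R" "y \<in> carrier R" and eq: "x \<ominus> y = \<zero>"
  shows "x = y"
proof -
  have "x = (x \<ominus> y) \<oplus> y"
    using assms(1-2) by algebra
  then show ?thesis
    using assms(1-2) by (simp add: eq)
qed

lemma (in ring_hom_ring) ideal_hom_zero_set: "ideal {x \<in> carrier R. h x = \<zero>\<^bsub>S\<^esub>} R"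
  using kernel_is_ideal unfolding a_kernel_def' .

section \<open>Symmetric algebras\<close>

text \<open>The inner product of \<open>poly_lift\<close>, isolated so that it can act as the
  multiplicative map on monomials in \<open>monoid_algebra_lift\<close>.\<close>

definition mset_prod :: "('a, 'm) monoid_scheme \<Rightarrow> ('b \<Rightarrow> 'a) \<Rightarrow> 'b multiset \<Rightarrow> 'a" where
  "mset_prod G \<phi> A = (\<Otimes>\<^bsub>G\<^esub>x \<in> set_mset A. \<phi> x [^]\<^bsub>G\<^esub> count A x)"

context comm_monoid
begin

lemma mset_prod_superset:
  assumes "finite V" "set_mset A \<subseteq> V" "\<And>x. x \<in> V \<Longrightarrow> \<phi> x \<in> carrier G"
  shows "mset_prod G \<phi> A = (\<Otimes>x \<in> V. \<phi> x [^] count A x)"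
  unfolding mset_prod_def using assms
  by (intro finprod_mono_neutral_cong_left) (auto simp: not_in_iff)

lemma mset_prod_closed:
  "(\<And>x. x \<in># A \<Longrightarrow> \<phi> x \<in> carrier G) \<Longrightarrow> mset_prod G \<phi> A \<in> carrier G"
  by (auto simp: mset_prod_def)

lemma mset_prod_empty [simp]: "mset_prod G \<phi> {#} = \<one>"
  by (simp add: mset_prod_def)

lemma mset_prod_single [simp]: "\<phi> x \<in> carrier G \<Longrightarrow> mset_prod G \<phi> {#x#} = \<phi> x"
  by (simp add: mset_prod_def)

text \<open>Exponents add over the common support; an element missing from \<open>A\<close> or
  \<open>B\<close> has exponent 0 there and contributes the factor 1.\<close>

lemma mset_prod_union:
  assumes "\<And>x. x \<in># A + B \<Longrightarrow> \<phi> x \<in> carrier G"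
  shows "mset_prod G \<phi> (A + B) = mset_prod G \<phi> A \<otimes> mset_prod G \<phi> B"
proof -
  let ?V = "set_mset (A + B)"
  have "mset_prod G \<phi> (A + B) = (\<Otimes>x \<in> ?V. \<phi> x [^] count A x \<otimes> \<phi> x [^] count B x)"
    unfolding mset_prod_def using assms
    by (intro finprod_cong') (auto simp: nat_pow_mult)
  also have "\<dots> = (\<Otimes>x \<in> ?V. \<phi> x [^] count A x) \<otimes> (\<Otimes>x \<in> ?V. \<phi> x [^] count B x)"
    using assms by (intro finprod_multf) auto
  also have "(\<Otimes>x \<in> ?V. \<phi> x [^] count A x) = mset_prod G \<phi> A"
    using assms by (intro mset_prod_superset[symmetric]) auto
  also have "(\<Otimes>x \<in> ?V. \<phi> x [^] count B x) = mset_prod G \<phi> B"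
    using assms by (intro mset_prod_superset[symmetric]) auto
  finally show ?thesis .
qed

end

lemma free_comm_monoid_comm_monoid: "comm_monoid (free_comm_monoid V)"
  by (rule comm_monoidI) (auto simp: free_comm_monoid_def)

lemma free_comm_monoid_simps [simp]:
  "A \<in> carrier (free_comm_monoid V) \<longleftrightarrow> set_mset A \<subseteq> V"
  "\<one>\<^bsub>free_comm_monoid V\<^esub> = {#}"
  "A \<otimes>\<^bsub>free_comm_monoid V\<^esub> B = A + B"
  by (auto simp: free_comm_monoid_def)

section \<open>The symmetric algebra as polynomials modulo linear relations\<close>

locale symmetric_algebra = module R M for R (structure) and M (structure)
begin

abbreviation P where "P \<equiv> sym_poly R M"
abbreviation L where "L \<equiv> sym_ideal R M"

sublocale MA: monoid_algebra_over R "free_comm_monoid (carrier M)"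
  rewrites "monoid_algebra R (free_comm_monoid (carrier M)) = sym_poly R M"
  by (intro monoid_algebra_over.intro is_cring free_comm_monoid_comm_monoid)
     (simp add: sym_poly_def)

sublocale P: cring "sym_poly R M"
  by (rule MA.MA_cring)

lemma single_closed [simp]:
  "set_mset A \<subseteq> carrier M \<Longrightarrow> r \<in> carrier R \<Longrightarrow> single R A r \<in> carrier P"
  using MA.single_closed by simp

lemma single_mult:
  "set_mset A \<subseteq> carrier M \<Longrightarrow> set_mset B \<subseteq> carrier M \<Longrightarrow> r \<in> carrier R \<Longrightarrow> s \<in> carrier R \<Longrightarrow>
    single R A r \<otimes>\<^bsub>P\<^esub> single R B s = single R (A + B) (r \<otimes> s)"
  using MA.MA_mult_single by simp

lemma L_ideal: "ideal L P"
  unfolding sym_ideal_def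
  by (rule P.genideal_ideal) auto

sublocale L: ideal "sym_ideal R M" "sym_poly R M"
  by (rule L_ideal)

lemma L_add:
  assumes "x \<in> carrier M" "y \<in> carrier M"
  shows "single R {#x \<oplus>\<^bsub>M\<^esub> y#} \<one> \<ominus>\<^bsub>P\<^esub> single R {#x#} \<one> \<ominus>\<^bsub>P\<^esub> single R {#y#} \<one> \<in> L"
  unfolding sym_ideal_def using assms
  by (intro subsetD[OF P.genideal_self]) auto

lemma L_smult:
  assumes "r \<in> carrier R" "x \<in> carrier M"
  shows "single R {#r \<odot>\<^bsub>M\<^esub> x#} \<one> \<ominus>\<^bsub>P\<^esub> single R {#x#} r \<in> L"
  unfolding sym_ideal_def using assms
  by (intro subsetD[OF P.genideal_self]) auto

lemma L_minimal:
  assumes "ideal K P"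
    and "\<And>x y. x \<in> carrier M \<Longrightarrow> y \<in> carrier M \<Longrightarrow>
      single R {#x \<oplus>\<^bsub>M\<^esub> y#} \<one> \<ominus>\<^bsub>P\<^esub> single R {#x#} \<one> \<ominus>\<^bsub>P\<^esub> single R {#y#} \<one> \<in> K"
    and "\<And>r x. r \<in> carrier R \<Longrightarrow> x \<in> carrier M \<Longrightarrow>
      single R {#r \<odot>\<^bsub>M\<^esub> x#} \<one> \<ominus>\<^bsub>P\<^esub> single R {#x#} r \<in> K"
  shows "L \<subseteq> K"
  unfolding sym_ideal_def using assms by (intro P.genideal_minimal) auto

sublocale S: cring "sym_algebra R M"
  unfolding sym_algebra_def by (rule L.quotient_is_cring) (rule P.is_cring)

abbreviation cls where "cls f \<equiv> L +>\<^bsub>P\<^esub> f"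

lemma S_cases:
  assumes "C \<in> carrier (sym_algebra R M)"
  obtains f where "f \<in> carrier P" "C = cls f"
  using assms unfolding sym_algebra_def by (rule L.FactRing_carrier_cases)

lemma cls_hom: "cls \<in> ring_hom P (sym_algebra R M)"
  unfolding sym_algebra_def by (rule L.rcos_ring_hom)

lemma cls_eq_zero_iff: "f \<in> carrier P \<Longrightarrow> cls f = \<zero>\<^bsub>sym_algebra R M\<^esub> \<longleftrightarrow> f \<in> L"
  unfolding sym_algebra_def by (rule L.coset_eq_zero_iff)

lemma P_induct [consumes 1, case_names zero add]:
  assumes "f \<in> carrier P" and "Q \<zero>\<^bsub>P\<^esub>"
    and "\<And>A r f. set_mset A \<subseteq> carrier M \<Longrightarrow> r \<in> carrier R \<Longrightarrow> f \<in> carrier P \<Longrightarrow> Q f \<Longrightarrow>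
      Q (single R A r \<oplus>\<^bsub>P\<^esub> f)"
  shows "Q f"
  using assms(1) by (rule MA.MA_induct) (use assms in auto)

lemma single_add_mset:
  "x \<in> carrier M \<Longrightarrow> set_mset A \<subseteq> carrier M \<Longrightarrow> r \<in> carrier R \<Longrightarrow>
    single R (add_mset x A) r = single R {#x#} \<one> \<otimes>\<^bsub>P\<^esub> single R A r"
  by (simp add: single_mult)

text \<open>Constants and variables generate the polynomial ring. This is used to identify a
  composite of maps with a quotient map without computing either on general polynomials.\<close>

lemma P_hom_eqI:
  assumes B: "ring B" and k: "k \<in> ring_hom P B" and k': "k' \<in> ring_hom P B"
    and const: "\<And>r. r \<in> carrier R \<Longrightarrow> k (single R {#} r) = k' (single R {#} r)"
    and var: "\<And>x. x \<in> carrier M \<Longrightarrow> k (single R {#x#} \<one>) = k' (single R {#x#} \<one>)"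
    and f: "f \<in> carrier P"
  shows "k f = k' f"
proof -
  interpret B: ring B by fact
  interpret k: ring_hom_ring P B k
    by (rule ring_hom_ringI2) (use k in \<open>auto intro: P.ring_axioms B\<close>)
  interpret k': ring_hom_ring P B k'
    by (rule ring_hom_ringI2) (use k' in \<open>auto intro: P.ring_axioms B\<close>)
  \<comment> \<open>Induction on the monomial, splitting off one variable at a time with
    \<open>single_add_mset\<close>.\<close>
  have single: "k (single R A r) = k' (single R A r)"
    if "set_mset A \<subseteq> carrier M" "r \<in> carrier R" for A r
    using that(1)
  proof (induction A)
    case (add x A)
    then have "x \<in> carrier M" "set_mset A \<subseteq> carrier M"
      by auto
    with add show ?case
      using that(2) by (simp only: single_add_mset[of x A r]) (simp add: var)
  qed (use that const in auto)
  show ?thesis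
    using f by (induction rule: P_induct) (simp_all add: single)
qed

lemma cls_ring_hom_ring: "ring_hom_ring P (sym_algebra R M) cls"
  by (rule ring_hom_ringI2[OF P.ring_axioms S.ring_axioms cls_hom])

lemma single_const_hom: "(\<lambda>r. single R {#} r) \<in> ring_hom R P"
  by (rule ring_hom_memI)
     (use MA.single_add MA.MA_one_eq in \<open>auto simp: single_mult\<close>)

lemma sym_const_hom: "(\<lambda>r. sym_const R M r) \<in> ring_hom R (sym_algebra R M)"
  using ring_hom_trans[OF single_const_hom cls_hom] by (simp add: sym_const_def comp_def)

lemma sym_gen_closed: "x \<in> carrier M \<Longrightarrow> sym_gen R M x \<in> carrier (sym_algebra R M)"
  unfolding sym_gen_def by (rule ring_hom_closed[OF cls_hom]) simp

lemma sym_gen_add: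
  assumes "x \<in> carrier M" "y \<in> carrier M"
  shows "sym_gen R M (x \<oplus>\<^bsub>M\<^esub> y) = sym_gen R M x \<oplus>\<^bsub>sym_algebra R M\<^esub> sym_gen R M y"
proof -
  interpret q: ring_hom_ring P "sym_algebra R M" cls
    by (rule cls_ring_hom_ring)
  have eq: "cls (single R {#x \<oplus>\<^bsub>M\<^esub> y#} \<one> \<ominus>\<^bsub>P\<^esub> single R {#x#} \<one> \<ominus>\<^bsub>P\<^esub> single R {#y#} \<one>) = \<zero>\<^bsub>sym_algebra R M\<^esub>"
    using assms L_add[of x y] by (subst cls_eq_zero_iff) auto
  show ?thesis
    unfolding sym_gen_def
    by (rule S.minus_minus_eq_zeroD) (use eq assms in \<open>simp_all add: q.hom_minus\<close>)
qed

lemma sym_gen_smult: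
  assumes "r \<in> carrier R" "x \<in> carrier M"
  shows "sym_gen R M (r \<odot>\<^bsub>M\<^esub> x) = sym_const R M r \<otimes>\<^bsub>sym_algebra R M\<^esub> sym_gen R M x"
proof -
  interpret q: ring_hom_ring P "sym_algebra R M" cls
    by (rule cls_ring_hom_ring)
  have eq: "cls (single R {#r \<odot>\<^bsub>M\<^esub> x#} \<one> \<ominus>\<^bsub>P\<^esub> single R {#x#} r) = \<zero>\<^bsub>sym_algebra R M\<^esub>"
    using assms L_smult[of r x] by (subst cls_eq_zero_iff) auto
  have "cls (single R {#r \<odot>\<^bsub>M\<^esub> x#} \<one>) = cls (single R {#x#} r)"
    by (rule S.minus_eq_zeroD) (use eq assms in \<open>simp_all add: q.hom_minus\<close>)
  also have "single R {#x#} r = single R {#} r \<otimes>\<^bsub>P\<^esub> single R {#x#} \<one>"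
    using assms by (simp add: single_mult)
  finally show ?thesis
    using assms by (simp add: sym_gen_def sym_const_def)
qed

end

section \<open>The universal property of the symmetric algebra\<close>

locale symmetric_algebra_map = symmetric_algebra R M + B: cring B
  for R (structure) and M (structure) and B (structure) +
  fixes h \<phi>
  assumes h_hom: "h \<in> ring_hom R B"
    and phi_closed [simp]: "x \<in> carrier M \<Longrightarrow> \<phi> x \<in> carrier B"
    and phi_add: "x \<in> carrier M \<Longrightarrow> y \<in> carrier M \<Longrightarrow> \<phi> (x \<oplus>\<^bsub>M\<^esub> y) = \<phi> x \<oplus>\<^bsub>B\<^esub> \<phi> y"
    and phi_smult: "r \<in> carrier R \<Longrightarrow> x \<in> carrier M \<Longrightarrow> \<phi> (r \<odot>\<^bsub>M\<^esub> x) = h r \<otimes>\<^bsub>B\<^esub> \<phi> x"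
begin

sublocale lift: monoid_algebra_lift R "free_comm_monoid (carrier M)" B h "mset_prod B \<phi>"
  rewrites "monoid_algebra R (free_comm_monoid (carrier M)) = sym_poly R M"
    and "MA_lift R B h (mset_prod B \<phi>) = poly_lift R B h \<phi>"
proof -
  show "monoid_algebra_lift R (free_comm_monoid (carrier M)) B h (mset_prod B \<phi>)"
  proof (intro monoid_algebra_lift.intro MA.monoid_algebra_over_axioms B.is_cring
      monoid_algebra_lift_axioms.intro h_hom)
    fix A assume "A \<in> carrier (free_comm_monoid (carrier M))"
    then show "mset_prod B \<phi> A \<in> carrier B"
      by (intro B.mset_prod_closed phi_closed) auto
  next
    fix A A' assume "A \<in> carrier (free_comm_monoid (carrier M))" "A' \<in> carrier (free_comm_monoid (carrier M))"
    then have "mset_prod B \<phi> (A + A') = mset_prod B \<phi> A \<otimes>\<^bsub>B\<^esub> mset_prod B \<phi> A'"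
      by (intro B.mset_prod_union phi_closed) auto
    then show "mset_prod B \<phi> (A \<otimes>\<^bsub>free_comm_monoid (carrier M)\<^esub> A') =
        mset_prod B \<phi> A \<otimes>\<^bsub>B\<^esub> mset_prod B \<phi> A'"
      by simp
  qed simp
  show "MA_lift R B h (mset_prod B \<phi>) = poly_lift R B h \<phi>"
    by (simp add: fun_eq_iff MA_lift_def poly_lift_def mset_prod_def)
qed (simp add: sym_poly_def)

abbreviation pl where "pl \<equiv> poly_lift R B h \<phi>"
abbreviation sl where "sl \<equiv> sym_lift R B h \<phi>"

lemma pl_single: "set_mset A \<subseteq> carrier M \<Longrightarrow> r \<in> carrier R \<Longrightarrow>
    pl (single R A r) = h r \<otimes>\<^bsub>B\<^esub> mset_prod B \<phi> A"
  using lift.lift_single by simp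

sublocale pl: ring_hom_cring P B pl
  by unfold_locales (rule lift.lift_ring_hom)

text \<open>The kernel of evaluation is an ideal, so it suffices to kill the generators;
  \<open>phi_add\<close> and \<open>phi_smult\<close> say precisely that these go to zero.\<close>

lemma pl_L: assumes "f \<in> L" shows "pl f = \<zero>\<^bsub>B\<^esub>"
proof -
  let ?K = "{f \<in> carrier P. pl f = \<zero>\<^bsub>B\<^esub>}"
  have "L \<subseteq> ?K"
  proof (rule L_minimal)
    show "ideal (?K) P"
      by (rule pl.ring.ideal_hom_zero_set)
  next
    fix x y assume xy: "x \<in> carrier M" "y \<in> carrier M"
    let ?f = "single R {#x \<oplus>\<^bsub>M\<^esub> y#} \<one> \<ominus>\<^bsub>P\<^esub> single R {#x#} \<one> \<ominus>\<^bsub>P\<^esub> single R {#y#} \<one>"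
    have "pl ?f = \<phi> x \<oplus>\<^bsub>B\<^esub> \<phi> y \<ominus>\<^bsub>B\<^esub> \<phi> x \<ominus>\<^bsub>B\<^esub> \<phi> y"
      using xy by (simp add: pl.ring.hom_minus pl_single phi_add)
    also have "\<dots> = \<zero>\<^bsub>B\<^esub>"
      using xy by (simp add: B.add_minus_minus)
    finally show "?f \<in> ?K"
      using xy by simp
  next
    fix r x assume rx: "r \<in> carrier R" "x \<in> carrier M"
    let ?f = "single R {#r \<odot>\<^bsub>M\<^esub> x#} \<one> \<ominus>\<^bsub>P\<^esub> single R {#x#} r"
    have "pl ?f = \<zero>\<^bsub>B\<^esub>"
      using rx by (simp add: pl.ring.hom_minus pl_single phi_smult B.minus_eq B.r_neg)
    then show "?f \<in> ?K"
      using rx by simp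
  qed
  from subsetD[OF this assms] show ?thesis
    by simp
qed

lemma sl_cls [simp]: "f \<in> carrier P \<Longrightarrow> sl (cls f) = pl f"
  unfolding sym_lift_def
  by (rule the_elem_coset[OF L_ideal pl.ring.ring_hom_ring_axioms pl_L])

lemma sl_hom: "sl \<in> ring_hom (sym_algebra R M) B"
  using the_elem_ring_hom[OF L_ideal pl.ring.ring_hom_ring_axioms pl_L]
  unfolding sym_lift_def sym_algebra_def by (simp add: fun_eq_iff)

text \<open>Passing to polynomial representatives, injectivity becomes the inclusion of the kernel
  of evaluation in the ideal of relations. Later arguments about linear type can thus avoid
  cosets.\<close>

lemma sl_iso_iff:
  "sl \<in> ring_iso (sym_algebra R M) B \<longleftrightarrow>
    (\<forall>f\<in>carrier P. pl f = \<zero>\<^bsub>B\<^esub> \<longrightarrow> f \<in> L) \<and> pl ` carrier P = carrier B"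
proof -
  interpret sl: ring_hom_ring "sym_algebra R M" B sl
    by (rule ring_hom_ringI2[OF S.ring_axioms B.ring_axioms sl_hom])
  have cls_closed: "cls f \<in> carrier (sym_algebra R M)" if "f \<in> carrier P" for f
    using cls_hom that by (rule ring_hom_closed)
  have "sl ` carrier (sym_algebra R M) = pl ` carrier P"
    by (auto simp: image_iff cls_closed elim!: S_cases) (metis cls_closed sl_cls)
  moreover have "inj_on sl (carrier (sym_algebra R M)) \<longleftrightarrow>
      (\<forall>f\<in>carrier P. pl f = \<zero>\<^bsub>B\<^esub> \<longrightarrow> f \<in> L)"
  proof
    assume inj: "inj_on sl (carrier (sym_algebra R M))"
    show "\<forall>f\<in>carrier P. pl f = \<zero>\<^bsub>B\<^esub> \<longrightarrow> f \<in> L"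
    proof (intro ballI impI)
      fix f assume f: "f \<in> carrier P" and "pl f = \<zero>\<^bsub>B\<^esub>"
      then have "sl (cls f) = sl \<zero>\<^bsub>sym_algebra R M\<^esub>"
        by simp
      then have "cls f = \<zero>\<^bsub>sym_algebra R M\<^esub>"
        by (rule inj_onD[OF inj _ cls_closed[OF f] S.zero_closed])
      with f show "f \<in> L"
        by (simp only: cls_eq_zero_iff)
    qed
  next
    assume ker: "\<forall>f\<in>carrier P. pl f = \<zero>\<^bsub>B\<^esub> \<longrightarrow> f \<in> L"
    show "inj_on sl (carrier (sym_algebra R M))"
    proof (rule inj_onI)
      fix C D assume CD: "C \<in> carrier (sym_algebra R M)" "D \<in> carrier (sym_algebra R M)" "sl C = sl D"
      obtain f where f: "f \<in> carrier P" "C = cls f" using CD(1) by (rule S_cases)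
      obtain g where g: "g \<in> carrier P" "D = cls g" using CD(2) by (rule S_cases)
      have "pl (f \<ominus>\<^bsub>P\<^esub> g) = \<zero>\<^bsub>B\<^esub>"
        using f g CD(3) by (simp add: pl.ring.hom_minus B.minus_eq B.r_neg)
      then have "f \<ominus>\<^bsub>P\<^esub> g \<in> L"
        using ker f g by blast
      then show "C = D"
        using f g by (simp add: L.coset_eq_iff)
    qed
  qed
  ultimately show ?thesis
    using sl_hom by (auto simp: ring_iso_def bij_betw_def)
qed

end

section \<open>Tensor products\<close>

lemma DirProd_comm_monoid:
  assumes "comm_monoid G" and "comm_monoid H"
  shows "comm_monoid (G \<times>\<times> H)"
proof -
  interpret G: comm_monoid G by fact
  interpret H: comm_monoid H by fact
  show ?thesis
    by (rule comm_monoidI) (auto simp: DirProd_def G.m_ac H.m_ac)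
qed

lemma (in ring) int_ring_hom: "(\<lambda>n. add_pow R (n::int) \<one>) \<in> ring_hom \<Z> R"
proof (rule ring_hom_memI)
  fix m n :: int
  have "add_pow R (m::int) \<one> \<otimes> add_pow R (n::int) \<one> = add_pow R m (add_pow R n \<one>)"
    by (simp add: add_pow_ldistr_int)
  also have "\<dots> = add_pow R (m * n::int) \<one>"
    by (simp add: add.int_pow_pow mult.commute)
  finally show "add_pow R (m \<otimes>\<^bsub>\<Z>\<^esub> n) \<one> = add_pow R (m::int) \<one> \<otimes> add_pow R (n::int) \<one>"
    by simp
qed (auto simp: add.int_pow_mult)

locale tensor_product = A: cring A + B: cring B + C: cring C
  for A (structure) and B (structure) and C (structure) +
  fixes f g
  assumes f_hom: "f \<in> ring_hom A B" and g_hom: "g \<in> ring_hom A C"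
begin

sublocale f: ring_hom_cring A B f
  by unfold_locales (rule f_hom)

sublocale g: ring_hom_cring A C g
  by unfold_locales (rule g_hom)

abbreviation F where "F \<equiv> tensor_free B C"
abbreviation J where "J \<equiv> tensor_ideal A B C f g"
abbreviation T where "T \<equiv> tensor_algebra A B C f g"
abbreviation tens where "tens \<equiv> pure_tensor A B C f g"

sublocale MA: monoid_algebra_over \<Z> "B \<times>\<times> C"
  rewrites "monoid_algebra \<Z> (B \<times>\<times> C) = tensor_free B C"
  by (intro monoid_algebra_over.intro int_is_cring DirProd_comm_monoid
        B.comm_monoid_axioms C.comm_monoid_axioms)
     (simp add: tensor_free_def)

sublocale F: cring "tensor_free B C"
  by (rule MA.MA_cring)

lemma single_closed [simp]:
  "b \<in> carrier B \<Longrightarrow> c \<in> carrier C \<Longrightarrow> single \<Z> (b, c) n \<in> carrier F"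
  using MA.single_closed by simp

sublocale J: ideal "tensor_ideal A B C f g" "tensor_free B C"
  unfolding tensor_ideal_def by (rule F.genideal_ideal) auto

sublocale T: cring "tensor_algebra A B C f g"
  unfolding tensor_algebra_def by (rule J.quotient_is_cring) (rule F.is_cring)

sublocale cls: ring_hom_cring F T "\<lambda>x. J +>\<^bsub>F\<^esub> x"
  using J.rcos_ring_hom by unfold_locales (simp only: tensor_algebra_def)

lemma cls_eq_zero: "x \<in> J \<Longrightarrow> J +>\<^bsub>F\<^esub> x = \<zero>\<^bsub>T\<^esub>"
  unfolding tensor_algebra_def by (subst J.coset_eq_zero_iff) (rule J.Icarr)

lemma tens_closed [simp]: "b \<in> carrier B \<Longrightarrow> c \<in> carrier C \<Longrightarrow> tens b c \<in> carrier T"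
  unfolding pure_tensor_def by (rule cls.hom_closed) (rule single_closed)

lemma tens_add_left:
  assumes "b \<in> carrier B" "b' \<in> carrier B" "c \<in> carrier C"
  shows "tens (b \<oplus>\<^bsub>B\<^esub> b') c = tens b c \<oplus>\<^bsub>T\<^esub> tens b' c"
proof -
  have "single \<Z> (b \<oplus>\<^bsub>B\<^esub> b', c) 1 \<ominus>\<^bsub>F\<^esub> single \<Z> (b, c) 1 \<ominus>\<^bsub>F\<^esub> single \<Z> (b', c) 1 \<in> J"
    unfolding tensor_ideal_def using assms by (intro subsetD[OF F.genideal_self]) auto
  from cls_eq_zero[OF this] have "tens (b \<oplus>\<^bsub>B\<^esub> b') c \<ominus>\<^bsub>T\<^esub> tens b c \<ominus>\<^bsub>T\<^esub> tens b' c = \<zero>\<^bsub>T\<^esub>"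
    using assms by (simp add: cls.ring.hom_minus pure_tensor_def)
  then show ?thesis
    by (rule T.minus_minus_eq_zeroD[rotated 3]) (use assms in auto)
qed

lemma tens_add_right:
  assumes "b \<in> carrier B" "c \<in> carrier C" "c' \<in> carrier C"
  shows "tens b (c \<oplus>\<^bsub>C\<^esub> c') = tens b c \<oplus>\<^bsub>T\<^esub> tens b c'"
proof -
  have "single \<Z> (b, c \<oplus>\<^bsub>C\<^esub> c') 1 \<ominus>\<^bsub>F\<^esub> single \<Z> (b, c) 1 \<ominus>\<^bsub>F\<^esub> single \<Z> (b, c') 1 \<in> J"
    unfolding tensor_ideal_def using assms by (intro subsetD[OF F.genideal_self]) auto
  from cls_eq_zero[OF this] have "tens b (c \<oplus>\<^bsub>C\<^esub> c') \<ominus>\<^bsub>T\<^esub> tens b c \<ominus>\<^bsub>T\<^esub> tens b c' = \<zero>\<^bsub>T\<^esub>"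
    using assms by (simp add: cls.ring.hom_minus pure_tensor_def)
  then show ?thesis
    by (rule T.minus_minus_eq_zeroD[rotated 3]) (use assms in auto)
qed

lemma tens_balanced:
  assumes "a \<in> carrier A" "b \<in> carrier B" "c \<in> carrier C"
  shows "tens (f a \<otimes>\<^bsub>B\<^esub> b) c = tens b (g a \<otimes>\<^bsub>C\<^esub> c)"
proof -
  have "single \<Z> (f a \<otimes>\<^bsub>B\<^esub> b, c) 1 \<ominus>\<^bsub>F\<^esub> single \<Z> (b, g a \<otimes>\<^bsub>C\<^esub> c) 1 \<in> J"
    unfolding tensor_ideal_def using assms by (intro subsetD[OF F.genideal_self]) auto
  from cls_eq_zero[OF this] have "tens (f a \<otimes>\<^bsub>B\<^esub> b) c \<ominus>\<^bsub>T\<^esub> tens b (g a \<otimes>\<^bsub>C\<^esub> c) = \<zero>\<^bsub>T\<^esub>"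
    using assms by (simp add: cls.ring.hom_minus pure_tensor_def)
  then show ?thesis
    by (rule T.minus_eq_zeroD[rotated 2]) (use assms in auto)
qed

lemma tens_mult:
  assumes "b \<in> carrier B" "b' \<in> carrier B" "c \<in> carrier C" "c' \<in> carrier C"
  shows "tens (b \<otimes>\<^bsub>B\<^esub> b') (c \<otimes>\<^bsub>C\<^esub> c') = tens b c \<otimes>\<^bsub>T\<^esub> tens b' c'"
proof -
  have "single \<Z> (b \<otimes>\<^bsub>B\<^esub> b', c \<otimes>\<^bsub>C\<^esub> c') 1 = single \<Z> (b, c) 1 \<otimes>\<^bsub>F\<^esub> single \<Z> (b', c') 1"
    using MA.MA_mult_single[of "(b, c)" "(b', c')" 1 1] assms by simp
  then show ?thesis using assms by (simp add: pure_tensor_def)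
qed

lemma tens_one: "tens \<one>\<^bsub>B\<^esub> \<one>\<^bsub>C\<^esub> = \<one>\<^bsub>T\<^esub>"
  using MA.MA_one_eq cls.hom_one by (simp add: pure_tensor_def)

lemma tens_left_hom: "(\<lambda>b. tens b \<one>\<^bsub>C\<^esub>) \<in> ring_hom B T"
  by (rule ring_hom_memI)
     (use tens_mult[of _ _ "\<one>\<^bsub>C\<^esub>" "\<one>\<^bsub>C\<^esub>"] in \<open>auto simp: tens_add_left tens_one\<close>)

sublocale tl: ring_hom_cring B T "\<lambda>b. tens b \<one>\<^bsub>C\<^esub>"
  by unfold_locales (rule tens_left_hom)

text \<open>From 0 = 0 + 0, the tensor of b and 0 equals its own double, and cancels.\<close>

lemma tens_right_zero: "b \<in> carrier B \<Longrightarrow> tens b \<zero>\<^bsub>C\<^esub> = \<zero>\<^bsub>T\<^esub>"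
  using tens_add_right[of b "\<zero>\<^bsub>C\<^esub>" "\<zero>\<^bsub>C\<^esub>"] T.add.r_cancel_one'[of "tens b \<zero>\<^bsub>C\<^esub>" "tens b \<zero>\<^bsub>C\<^esub>"]
  by simp

text \<open>Balancing moves a across the tensor sign, where \<open>g\<close> annihilates it. With
  the Rees algebra as \<open>C\<close>, this sends the kernel of the map to the Rees algebra into
  the kernel of the map between symmetric algebras.\<close>

lemma tens_left_inj_imp_kernel_le:
  assumes inj: "inj_on (\<lambda>b. tens b \<one>\<^bsub>C\<^esub>) (carrier B)"
    and a: "a \<in> carrier A" "g a = \<zero>\<^bsub>C\<^esub>"
  shows "f a = \<zero>\<^bsub>B\<^esub>"
proof -
  have "tens (f a) \<one>\<^bsub>C\<^esub> = tens \<one>\<^bsub>B\<^esub> (g a)"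
    using tens_balanced[of a "\<one>\<^bsub>B\<^esub>" "\<one>\<^bsub>C\<^esub>"] a by simp
  also have "\<dots> = tens \<zero>\<^bsub>B\<^esub> \<one>\<^bsub>C\<^esub>"
    using a tens_right_zero[of "\<one>\<^bsub>B\<^esub>"] by simp
  finally show ?thesis
    by (rule inj_onD[OF inj]) (use a in auto)
qed

end

section \<open>Base change along an isomorphism\<close>

locale tensor_product_iso = tensor_product +
  assumes g_bij: "bij_betw g (carrier A) (carrier C)"
begin

abbreviation ginv where "ginv \<equiv> inv_into (carrier A) g"

lemma ginv_closed [simp]: "c \<in> carrier C \<Longrightarrow> ginv c \<in> carrier A"
  using g_bij by (metis bij_betw_imp_surj_on inv_into_into)

lemma g_ginv [simp]: "c \<in> carrier C \<Longrightarrow> g (ginv c) = c"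
  using g_bij by (metis bij_betw_imp_surj_on f_inv_into_f)

lemma ginv_g: "a \<in> carrier A \<Longrightarrow> ginv (g a) = a"
  using g_bij by (simp add: bij_betw_def)

lemma ginv_unique: "a \<in> carrier A \<Longrightarrow> g a = c \<Longrightarrow> ginv c = a"
  using ginv_g by blast

text \<open>The only possible left inverse of the map from b to the tensor of b and 1: balancing
  forces the tensor of b and c to equal that of b times \<open>f (ginv c)\<close> and 1. It is set
  up on the free group first and then shown to respect the relations.\<close>

abbreviation retr where "retr \<equiv> MA_lift \<Z> B (\<lambda>n. [n] \<cdot>\<^bsub>B\<^esub> \<one>\<^bsub>B\<^esub>) (\<lambda>(b, c). b \<otimes>\<^bsub>B\<^esub> f (ginv c))"

sublocale rl: monoid_algebra_lift \<Z> "B \<times>\<times> C" B "\<lambda>n. [n] \<cdot>\<^bsub>B\<^esub> \<one>\<^bsub>B\<^esub>" "\<lambda>(b, c). b \<otimes>\<^bsub>B\<^esub> f (ginv c)"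
  rewrites "monoid_algebra \<Z> (B \<times>\<times> C) = tensor_free B C"
proof -
  have "ginv (c \<otimes>\<^bsub>C\<^esub> c') = ginv c \<otimes>\<^bsub>A\<^esub> ginv c'" if "c \<in> carrier C" "c' \<in> carrier C" for c c'
    using that by (intro ginv_unique) auto
  moreover have "ginv \<one>\<^bsub>C\<^esub> = \<one>\<^bsub>A\<^esub>"
    by (intro ginv_unique) auto
  ultimately show "monoid_algebra_lift \<Z> (B \<times>\<times> C) B (\<lambda>n. [n] \<cdot>\<^bsub>B\<^esub> \<one>\<^bsub>B\<^esub>) (\<lambda>(b, c). b \<otimes>\<^bsub>B\<^esub> f (ginv c))"
    by (intro monoid_algebra_lift.intro MA.monoid_algebra_over_axioms B.is_cring
          monoid_algebra_lift_axioms.intro B.int_ring_hom)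
       (auto simp: B.m_ac)
qed (simp add: tensor_free_def)

sublocale retr: ring_hom_cring F B retr
  by unfold_locales (rule rl.lift_ring_hom)

lemma retr_single:
  assumes "b \<in> carrier B" "c \<in> carrier C"
  shows "retr (single \<Z> (b, c) 1) = b \<otimes>\<^bsub>B\<^esub> f (ginv c)"
proof -
  have "retr (single \<Z> (b, c) 1) = add_pow B (1::int) \<one>\<^bsub>B\<^esub> \<otimes>\<^bsub>B\<^esub> (b \<otimes>\<^bsub>B\<^esub> f (ginv c))"
    using rl.lift_single[of "(b, c)" 1] assms by simp
  also have "add_pow B (1::int) \<one>\<^bsub>B\<^esub> = \<one>\<^bsub>B\<^esub>"
    using ring_hom_one[OF B.int_ring_hom] by simp
  finally show ?thesis using assms by simp
qed

text \<open>The additivity relations vanish because \<open>f\<close> and the inverse of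
  \<open>g\<close> are additive; the balancing relation vanishes because that inverse turns
  \<open>g a\<close> times c into a times \<open>ginv c\<close>.\<close>

lemma retr_J:
  assumes "x \<in> J" shows "retr x = \<zero>\<^bsub>B\<^esub>"
proof -
  let ?K = "{x \<in> carrier F. retr x = \<zero>\<^bsub>B\<^esub>}"
  have ginv_add: "ginv (c \<oplus>\<^bsub>C\<^esub> c') = ginv c \<oplus>\<^bsub>A\<^esub> ginv c'" if "c \<in> carrier C" "c' \<in> carrier C" for c c'
    using that by (intro ginv_unique) auto
  have ginv_mult: "ginv (g a \<otimes>\<^bsub>C\<^esub> c) = a \<otimes>\<^bsub>A\<^esub> ginv c" if "a \<in> carrier A" "c \<in> carrier C" for a c
    using that by (intro ginv_unique) auto
  have 1: "retr (single \<Z> (b \<oplus>\<^bsub>B\<^esub> b', c) 1 \<ominus>\<^bsub>F\<^esub> single \<Z> (b, c) 1 \<ominus>\<^bsub>F\<^esub> single \<Z> (b', c) 1) = \<zero>\<^bsub>B\<^esub>"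
    if "b \<in> carrier B" "b' \<in> carrier B" "c \<in> carrier C" for b b' c
    using that by (simp add: retr.ring.hom_minus retr_single B.l_distr B.add_minus_minus)
  have 2: "retr (single \<Z> (b, c \<oplus>\<^bsub>C\<^esub> c') 1 \<ominus>\<^bsub>F\<^esub> single \<Z> (b, c) 1 \<ominus>\<^bsub>F\<^esub> single \<Z> (b, c') 1) = \<zero>\<^bsub>B\<^esub>"
    if "b \<in> carrier B" "c \<in> carrier C" "c' \<in> carrier C" for b c c'
    using that by (simp add: retr.ring.hom_minus retr_single ginv_add B.r_distr B.add_minus_minus)
  have 3: "retr (single \<Z> (f a \<otimes>\<^bsub>B\<^esub> b, c) 1 \<ominus>\<^bsub>F\<^esub> single \<Z> (b, g a \<otimes>\<^bsub>C\<^esub> c) 1) = \<zero>\<^bsub>B\<^esub>"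
    if "a \<in> carrier A" "b \<in> carrier B" "c \<in> carrier C" for a b c
    using that by (simp add: retr.ring.hom_minus retr_single ginv_mult B.m_ac B.minus_eq B.r_neg)
  have "J \<subseteq> ?K"
    unfolding tensor_ideal_def
    by (rule F.genideal_minimal[OF retr.ring.ideal_hom_zero_set], intro Un_least subsetI;
        elim CollectE exE conjE; hypsubst; intro CollectI conjI)
       (erule (2) 1 2 3 | simp)+
  from subsetD[OF this assms] show ?thesis by simp
qed

lemma tens_left_inj: "inj_on (\<lambda>b. tens b \<one>\<^bsub>C\<^esub>) (carrier B)"
proof (rule inj_onI)
  fix b b' assume b: "b \<in> carrier B" "b' \<in> carrier B" and eq: "tens b \<one>\<^bsub>C\<^esub> = tens b' \<one>\<^bsub>C\<^esub>"
  have ginv_one: "ginv \<one>\<^bsub>C\<^esub> = \<one>\<^bsub>A\<^esub>"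
    by (rule ginv_unique) auto
  \<comment> \<open>Equality of two pure tensors is membership of the difference in
    \<open>J\<close>, where \<open>retr\<close> vanishes; on these tensors it returns b and
    b'.\<close>
  have "single \<Z> (b, \<one>\<^bsub>C\<^esub>) 1 \<ominus>\<^bsub>F\<^esub> single \<Z> (b', \<one>\<^bsub>C\<^esub>) 1 \<in> J"
    using b eq by (simp add: pure_tensor_def J.coset_eq_iff)
  from retr_J[OF this] have "b \<ominus>\<^bsub>B\<^esub> b' = \<zero>\<^bsub>B\<^esub>"
    using b by (simp add: retr.ring.hom_minus retr_single ginv_one)
  then show "b = b'"
    by (rule B.minus_eq_zeroD[rotated 2]) (use b in auto)
qed

text \<open>Every c is \<open>g (ginv c)\<close>, so balancing turns a pure tensor into one with
  right factor 1. The image is closed under sums and differences, and pure tensors generate.\<close>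

lemma tens_left_surj:
  assumes "t \<in> carrier T"
  shows "t \<in> (\<lambda>b. tens b \<one>\<^bsub>C\<^esub>) ` carrier B"
proof -
  let ?Im = "(\<lambda>b. tens b \<one>\<^bsub>C\<^esub>) ` carrier B"
  have add: "x \<oplus>\<^bsub>T\<^esub> y \<in> ?Im" if "x \<in> ?Im" "y \<in> ?Im" for x y
    using that by (auto simp flip: tl.hom_add)
  have diff: "x \<ominus>\<^bsub>T\<^esub> y \<in> ?Im" if "x \<in> ?Im" "y \<in> ?Im" for x y
    using that by (auto simp flip: tl.ring.hom_minus)
  have zero: "\<zero>\<^bsub>T\<^esub> \<in> ?Im"
    using tl.hom_zero by (metis B.zero_closed imageI)
  have one: "tens b c \<in> ?Im" if "b \<in> carrier B" "c \<in> carrier C" for b c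
  proof -
    have "tens b c = tens (f (ginv c) \<otimes>\<^bsub>B\<^esub> b) \<one>\<^bsub>C\<^esub>"
      using tens_balanced[of "ginv c" b "\<one>\<^bsub>C\<^esub>"] that by simp
    then show ?thesis
      by (rule image_eqI) (use that in simp)
  qed
  have single: "J +>\<^bsub>F\<^esub> single \<Z> (b, c) n \<in> ?Im" if bc: "b \<in> carrier B" "c \<in> carrier C" for b c n
  \<comment> \<open>Coefficients are integers, hence the induction goes up and down from 0, using
    closure under differences for the downward step.\<close>
  proof (induction n rule: int_induct[where k = 0])
    case base
    have "single \<Z> (b, c) 0 = \<zero>\<^bsub>F\<^esub>"
      using MA.single_zero by simp
    then show ?case using zero by simp
  next
    case (step1 i)
    have "single \<Z> (b, c) (i + 1) = single \<Z> (b, c) i \<oplus>\<^bsub>F\<^esub> single \<Z> (b, c) 1"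
      using MA.single_add[of i 1 "(b, c)"] by simp
    then show ?case
      using add[OF step1(2) one[OF bc]] bc by (simp add: pure_tensor_def)
  next
    case (step2 i)
    have "single \<Z> (b, c) i = single \<Z> (b, c) (i - 1) \<oplus>\<^bsub>F\<^esub> single \<Z> (b, c) 1"
      using MA.single_add[of "i - 1" 1 "(b, c)"] by simp
    then have "single \<Z> (b, c) (i - 1) = single \<Z> (b, c) i \<ominus>\<^bsub>F\<^esub> single \<Z> (b, c) 1"
      using bc by (simp add: F.minus_eq F.a_assoc F.r_neg)
    then show ?case
      using diff[OF step2(2) one[OF bc]] bc by (simp add: pure_tensor_def cls.ring.hom_minus)
  qed
  obtain x where x: "x \<in> carrier F" "t = J +>\<^bsub>F\<^esub> x"
    using assms unfolding tensor_algebra_def by (rule J.FactRing_carrier_cases)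
  from x(1) have "J +>\<^bsub>F\<^esub> x \<in> ?Im"
  proof (induction rule: MA.MA_induct)
    case zero
    then show ?case using \<open>\<zero>\<^bsub>T\<^esub> \<in> ?Im\<close> by simp
  next
    case (add z n x)
    then obtain b c where "z = (b, c)" "b \<in> carrier B" "c \<in> carrier C" by auto
    then show ?case using \<open>x \<in> carrier F\<close> add.IH single[of b c n] by (simp add: assms \<open>\<And>x y. x \<in> ?Im \<Longrightarrow> y \<in> ?Im \<Longrightarrow> x \<oplus>\<^bsub>T\<^esub> y \<in> ?Im\<close>)
  qed
  then show ?thesis using x by simp
qed

lemma tens_left_iso: "(\<lambda>b. tens b \<one>\<^bsub>C\<^esub>) \<in> ring_iso B T"
  unfolding ring_iso_def bij_betw_def
  using tens_left_hom tens_left_inj tens_left_surj by auto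

end

section \<open>Rees algebras\<close>

text \<open>Keeps the degree of the monomials x u as the literal \<open>1\<close>, so that facts
  about \<open>mon x 1\<close> still match after simplification.\<close>

declare One_nat_def [simp del]

locale cring_ideal = cring R + I: ideal I R for R (structure) and I
begin

sublocale U: UP_cring R "UP R"
  by unfold_locales

definition ideal_pow where "ideal_pow t = I [^]\<^bsub>ideals_set R\<^esub> (t::nat)"

lemma ideal_pow_0 [simp]: "ideal_pow 0 = carrier R"
  by (simp add: ideal_pow_def nat_pow_def ideals_set_def)

lemma ideal_pow_Suc: "ideal_pow (Suc t) = ideal_prod R (ideal_pow t) I"
  by (simp add: ideal_pow_def nat_pow_def ideals_set_def)

lemma ideal_pow_ideal: "ideal (ideal_pow t) R"
  by (induction t) (simp_all add: ideal_pow_Suc oneideal ideal_prod_is_ideal I.is_ideal)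

text \<open>Powers are taken in the commutative monoid of ideals under \<open>ideal_prod\<close>,
  where exponents add.\<close>

lemma ideal_pow_mult: "x \<in> ideal_pow i \<Longrightarrow> y \<in> ideal_pow j \<Longrightarrow> x \<otimes> y \<in> ideal_pow (i + j)"
proof -
  interpret IS: comm_monoid "ideals_set R" by (rule ideals_set_is_comm_monoid)
  have "ideal_pow (i + j) = ideal_pow i \<otimes>\<^bsub>ideals_set R\<^esub> ideal_pow j"
    unfolding ideal_pow_def by (rule IS.nat_pow_mult[symmetric]) (simp add: ideals_set_def I.is_ideal)
  also have "\<dots> = ideal_prod R (ideal_pow i) (ideal_pow j)"
    by (simp add: ideals_set_def)
  finally show "x \<in> ideal_pow i \<Longrightarrow> y \<in> ideal_pow j \<Longrightarrow> x \<otimes> y \<in> ideal_pow (i + j)"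
    by (simp add: ideal_prod.prod)
qed

lemma ideal_pow_1: "x \<in> I \<Longrightarrow> x \<in> ideal_pow 1"
  using ideal_prod.prod[of \<one> "carrier R" x I R] by (simp add: One_nat_def ideal_pow_Suc I.Icarr)

abbreviation cf where "cf \<equiv> up_ring.coeff (UP R)"
abbreviation mon where "mon \<equiv> up_ring.monom (UP R)"
abbreviation Rees where "Rees \<equiv> rees_algebra R I"

lemma Rees_carrier_iff: "p \<in> carrier Rees \<longleftrightarrow> p \<in> carrier (UP R) \<and> (\<forall>t. cf p t \<in> ideal_pow t)"
  by (simp add: rees_algebra_def ideal_pow_def)

lemma Rees_simps [simp]:
  "p \<otimes>\<^bsub>Rees\<^esub> q = p \<otimes>\<^bsub>UP R\<^esub> q" "p \<oplus>\<^bsub>Rees\<^esub> q = p \<oplus>\<^bsub>UP R\<^esub> q"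
  "\<one>\<^bsub>Rees\<^esub> = \<one>\<^bsub>UP R\<^esub>" "\<zero>\<^bsub>Rees\<^esub> = \<zero>\<^bsub>UP R\<^esub>"
  by (simp_all add: rees_algebra_def)

lemma Rees_cring: "cring Rees"
proof -
  let ?H = "{p \<in> carrier (UP R). \<forall>t. cf p t \<in> ideal_pow t}"
  have fin: "(\<Oplus>i\<in>A. h i) \<in> ideal_pow t" if "finite A" "\<And>i. i \<in> A \<Longrightarrow> h i \<in> ideal_pow t" for A :: "nat set" and h t
  proof -
    interpret W: ideal "ideal_pow t" R by (rule ideal_pow_ideal)
    show ?thesis
      using that by (induction rule: finite_induct) auto
  qed
  have "subring ?H (UP R)"
  proof (rule U.P.subringI)
    show "\<one>\<^bsub>UP R\<^esub> \<in> ?H"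
      using ideal.axioms(1)[OF ideal_pow_ideal, THEN additive_subgroup.zero_closed] by simp
  next
    fix p assume p: "p \<in> ?H"
    then show "\<ominus>\<^bsub>UP R\<^esub> p \<in> ?H"
      using ideal.axioms(1)[OF ideal_pow_ideal, THEN additive_subgroup.a_inv_closed] by simp
  next
    fix p q assume pq: "p \<in> ?H" "q \<in> ?H"
    then show "p \<oplus>\<^bsub>UP R\<^esub> q \<in> ?H"
      using ideal.axioms(1)[OF ideal_pow_ideal, THEN additive_subgroup.a_closed] by simp
    \<comment> \<open>Each summand of the coefficient of u^t in a product lies in the product of the
      i-th and (t - i)-th powers of \<open>I\<close>; \<open>fin\<close> then sums them.\<close>
    have "cf p i \<otimes> cf q (t - i) \<in> ideal_pow t" if "i \<le> t" for i t
      using ideal_pow_mult[of "cf p i" i "cf q (t - i)" "t - i"] pq that by simp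
    then show "p \<otimes>\<^bsub>UP R\<^esub> q \<in> ?H"
      using pq by (auto intro!: fin)
  qed auto
  then have "subcring ?H (UP R)"
    by (rule U.P.subcringI')
  then have "cring ((UP R)\<lparr>carrier := ?H\<rparr>)"
    by (subst (asm) U.P.subcring_iff) auto
  then show ?thesis
    by (simp add: rees_algebra_def ideal_pow_def)
qed

sublocale Rees: cring "rees_algebra R I"
  by (rule Rees_cring)

lemma mon_Rees [simp]: "x \<in> ideal_pow t \<Longrightarrow> mon x t \<in> carrier Rees"
  using ideal.axioms(1)[OF ideal_pow_ideal, THEN additive_subgroup.zero_closed] ideal.Icarr[OF ideal_pow_ideal]
  by (simp add: Rees_carrier_iff)

section \<open>The map from the symmetric algebra of the ideal to the Rees algebra\<close>

abbreviation IM where "IM \<equiv> ideal_module R I"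

lemma IM_simps [simp]:
  "carrier IM = I" "x \<oplus>\<^bsub>IM\<^esub> y = x \<oplus> y" "r \<odot>\<^bsub>IM\<^esub> x = r \<otimes> x" "\<zero>\<^bsub>IM\<^esub> = \<zero>"
  by (simp_all add: ideal_module_def)

lemma IM_module: "module R IM"
proof (rule moduleI)
  show "abelian_group IM"
  proof (rule abelian_groupI)
    fix x assume "x \<in> carrier IM"
    then show "\<exists>y\<in>carrier IM. y \<oplus>\<^bsub>IM\<^esub> x = \<zero>\<^bsub>IM\<^esub>"
      by (intro bexI[of _ "\<ominus> x"]) (auto simp: l_neg)
  qed (auto simp: a_ac)
qed (auto simp: is_cring I.I_l_closed l_distr r_distr m_assoc)

sublocale Sym: symmetric_algebra R "ideal_module R I"
  by (intro symmetric_algebra.intro IM_module)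

sublocale alpha: symmetric_algebra_map R "ideal_module R I" "rees_algebra R I" "\<lambda>r. mon r 0" "\<lambda>x. mon x 1"
proof (intro symmetric_algebra_map.intro Sym.symmetric_algebra_axioms Rees_cring
    symmetric_algebra_map_axioms.intro)
  show "(\<lambda>r. mon r 0) \<in> ring_hom R Rees"
    using U.monom_mult[of _ _ 0 0] by (intro ring_hom_memI) (auto simp del: U.monom_mult)
next
  fix x assume "x \<in> carrier IM"
  then show "mon x 1 \<in> carrier Rees"
    by (intro mon_Rees ideal_pow_1) simp
next
  fix x y assume "x \<in> carrier IM" "y \<in> carrier IM"
  then show "mon (x \<oplus>\<^bsub>IM\<^esub> y) 1 = mon x 1 \<oplus>\<^bsub>Rees\<^esub> mon y 1"
    by simp
next
  fix r x assume "r \<in> carrier R" "x \<in> carrier IM"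
  then show "mon (r \<odot>\<^bsub>IM\<^esub> x) 1 = mon r 0 \<otimes>\<^bsub>Rees\<^esub> mon x 1"
    using U.monom_mult[of r x 0 1] by simp
qed

abbreviation rees_eval where "rees_eval \<equiv> poly_lift R Rees (\<lambda>r. mon r 0) (\<lambda>x. mon x 1)"
abbreviation Pol where "Pol \<equiv> sym_poly R IM"

lemma mset_prod_R_closed [simp]: "set_mset A \<subseteq> I \<Longrightarrow> mset_prod R (\<lambda>x. x) A \<in> carrier R"
  by (rule mset_prod_closed) auto

text \<open>Each variable contributes one factor u, so the number of variables becomes the exponent
  of u. This is why evaluation respects degrees.\<close>

lemma mset_prod_mon:
  "set_mset A \<subseteq> I \<Longrightarrow> mset_prod Rees (\<lambda>x. mon x 1) A = mon (mset_prod R (\<lambda>x. x) A) (size A)"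
proof (induction A)
  case (add x A)
  then have x: "x \<in> I" and A: "set_mset A \<subseteq> I" by auto
  have closed: "mon y 1 \<in> carrier Rees" if "y \<in> I" for y
    by (intro mon_Rees ideal_pow_1 that)
  have "mset_prod Rees (\<lambda>x. mon x 1) ({#x#} + A) = mon x 1 \<otimes>\<^bsub>UP R\<^esub> mset_prod Rees (\<lambda>x. mon x 1) A"
    using x A closed by (subst Rees.mset_prod_union) auto
  also have "\<dots> = mon (x \<otimes> mset_prod R (\<lambda>x. x) A) (1 + size A)"
    using x A add.IH by (subst U.monom_mult) auto
  also have "x \<otimes> mset_prod R (\<lambda>x. x) A = mset_prod R (\<lambda>x. x) ({#x#} + A)"
    using x A by (subst mset_prod_union) auto
  finally show ?case by (simp add: One_nat_def)
qed simp

lemma rees_eval_single: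
  assumes "set_mset A \<subseteq> I" "r \<in> carrier R"
  shows "rees_eval (single R A r) = mon (r \<otimes> mset_prod R (\<lambda>x. x) A) (size A)"
  using assms U.monom_mult[of r "mset_prod R (\<lambda>x. x) A" 0 "size A"]
  by (simp add: alpha.pl_single mset_prod_mon)

text \<open>The image is closed under sums and products, contains R and all x u with x in
  \<open>I\<close>, and these generate the Rees algebra.\<close>

lemma rees_eval_surj: "rees_eval ` carrier Pol = carrier Rees"
proof
  show "rees_eval ` carrier Pol \<subseteq> carrier Rees" by auto
  have add: "p \<oplus>\<^bsub>UP R\<^esub> q \<in> rees_eval ` carrier Pol" if pq: "p \<in> rees_eval ` carrier Pol" "q \<in> rees_eval ` carrier Pol" for p q
  proof -
    obtain f g where "f \<in> carrier Pol" "g \<in> carrier Pol" "p = rees_eval f" "q = rees_eval g"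
      using pq by (elim imageE) blast
    then show ?thesis
      by (intro image_eqI[of _ _ "f \<oplus>\<^bsub>Pol\<^esub> g"]) auto
  qed
  have mult: "p \<otimes>\<^bsub>UP R\<^esub> q \<in> rees_eval ` carrier Pol" if pq: "p \<in> rees_eval ` carrier Pol" "q \<in> rees_eval ` carrier Pol" for p q
  proof -
    obtain f g where "f \<in> carrier Pol" "g \<in> carrier Pol" "p = rees_eval f" "q = rees_eval g"
      using pq by (elim imageE) blast
    then show ?thesis
      by (intro image_eqI[of _ _ "f \<otimes>\<^bsub>Pol\<^esub> g"]) auto
  qed
  have monom: "mon x t \<in> rees_eval ` carrier Pol" if "x \<in> ideal_pow t" for x t
    using that
  proof (induction t arbitrary: x)
    case 0
    then have "rees_eval (single R {#} x) = mon x 0"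
      by (simp add: rees_eval_single)
    then show ?case
      using 0 by (intro image_eqI[of _ _ "single R {#} x"]) auto
  next
    case (Suc t)
    \<comment> \<open>An inner induction over the generation of the ideal product: a generator i j
      gives i j u^(t+1) = (i u^t)(j u), and sums stay in the image.\<close>
    from Suc.prems have "x \<in> ideal_prod R (ideal_pow t) I"
      by (simp only: ideal_pow_Suc)
    then show ?case
    proof (induction rule: ideal_prod.induct)
      case (prod i j)
      have "rees_eval (single R {#j#} \<one>) = mon j 1"
        using prod by (simp add: rees_eval_single)
      then have "mon j 1 \<in> rees_eval ` carrier Pol"
        using prod by (intro image_eqI[of _ _ "single R {#j#} \<one>"]) auto
      moreover have "mon i t \<in> rees_eval ` carrier Pol"
        using prod by (intro Suc.IH)
      ultimately have "mon i t \<otimes>\<^bsub>UP R\<^esub> mon j 1 \<in> rees_eval ` carrier Pol"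
        by (intro mult)
      then show ?case
        using U.monom_mult[of i j t 1] prod ideal.Icarr[OF ideal_pow_ideal]
        by (simp add: One_nat_def del: U.monom_mult)
    next
      case (sum s1 s2)
      have "s1 \<in> carrier R" "s2 \<in> carrier R"
        using sum ideal.Icarr[OF ideal_pow_ideal, of _ "Suc t"] by (auto simp: ideal_pow_Suc)
      then show ?case
        using add[OF sum.IH] by simp
    qed
  qed
  show "carrier Rees \<subseteq> rees_eval ` carrier Pol"
  proof
    fix p assume p: "p \<in> carrier Rees"
    then have pU: "p \<in> carrier (UP R)" and "cf p t \<in> ideal_pow t" for t
      by (auto simp: Rees_carrier_iff)
    \<comment> \<open>An element of the Rees algebra is the sum of its terms up to its degree; the
      partial sums are shown to lie in the image one by one.\<close>
    have "(\<Oplus>\<^bsub>UP R\<^esub> i \<in> {..n}. mon (cf p i) i) \<in> rees_eval ` carrier Pol" for n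
    proof (induction n)
      case 0
      then show ?case using monom[of "cf p 0" 0] pU by simp
    next
      case (Suc n)
      have "mon (cf p (Suc n)) (Suc n) \<in> rees_eval ` carrier Pol"
        by (intro monom) fact
      from add[OF this Suc] show ?case
        using pU by simp
    qed
    from this[of "deg R p"] show "p \<in> rees_eval ` carrier Pol"
      using U.up_repr[OF pU] by simp
  qed
qed

lemma linear_type_iff:
  "linear_type R I \<longleftrightarrow> (\<forall>f\<in>carrier Pol. rees_eval f = \<zero>\<^bsub>UP R\<^esub> \<longrightarrow> f \<in> sym_ideal R IM)"
  unfolding linear_type_def sym_to_rees_def alpha.sl_iso_iff by (simp add: rees_eval_surj)

section \<open>The grading by the number of variables\<close>

abbreviation SI where "SI \<equiv> sym_ideal R IM"

text \<open>The homogeneous component of degree t. Only variables count: an element of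
  \<open>I\<close> occurring as a coefficient has degree 0.\<close>

definition hcomp :: "nat \<Rightarrow> ('a multiset \<Rightarrow> 'a) \<Rightarrow> 'a multiset \<Rightarrow> 'a" where
  "hcomp t f = (\<lambda>A. if size A = t then f A else \<zero>)"

lemma Pol_carrier_iff:
  "f \<in> carrier Pol \<longleftrightarrow>
    (\<forall>A. f A \<in> carrier R) \<and> finite (coeff_supp R f) \<and> coeff_supp R f \<subseteq> {A. set_mset A \<subseteq> I}"
  using Sym.MA.MA_carrier_iff[of f] by (auto simp: subset_iff)

lemmas Pol_apply = Sym.MA.MA_add_apply Sym.MA.MA_zero_apply

lemma hcomp_closed [simp]:
  assumes f: "f \<in> carrier Pol"
  shows "hcomp t f \<in> carrier Pol"
proof -
  have "coeff_supp R (hcomp t f) \<subseteq> coeff_supp R f"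
    by (auto simp: coeff_supp_def hcomp_def)
  with f show ?thesis
    by (auto simp: Pol_carrier_iff hcomp_def intro: finite_subset)
qed

lemma hcomp_zero [simp]: "hcomp t \<zero>\<^bsub>Pol\<^esub> = \<zero>\<^bsub>Pol\<^esub>"
  by (auto simp: hcomp_def Pol_apply)

lemma hcomp_add:
  "hcomp t (f \<oplus>\<^bsub>Pol\<^esub> g) = hcomp t f \<oplus>\<^bsub>Pol\<^esub> hcomp t g"
  by (auto simp: hcomp_def Pol_apply)

lemma hcomp_hcomp: "hcomp s (hcomp t f) = (if s = t then hcomp t f else \<zero>\<^bsub>Pol\<^esub>)"
  by (auto simp: hcomp_def Pol_apply)

sublocale hcomp: abelian_group_hom "sym_poly R IM" "sym_poly R IM" "hcomp t" for t
  by (intro abelian_group_homI Sym.P.abelian_group_axioms group_hom.intro Sym.P.a_group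
        group_hom_axioms.intro homI)
     (simp_all add: hcomp_add)

lemma hcomp_single: "hcomp t (single R A r) = (if size A = t then single R A r else \<zero>\<^bsub>Pol\<^esub>)"
  by (auto simp: hcomp_def single_def Pol_apply)

text \<open>A monomial shifts degrees by its size. The case distinction is essential: for
  \<open>size A\<close> above t, truncated subtraction would wrongly select the constant term of
  f.\<close>

lemma hcomp_mult_single:
  assumes "set_mset A \<subseteq> I" "r \<in> carrier R" "f \<in> carrier Pol"
  shows "hcomp t (single R A r \<otimes>\<^bsub>Pol\<^esub> f) =
    (if size A \<le> t then single R A r \<otimes>\<^bsub>Pol\<^esub> hcomp (t - size A) f else \<zero>\<^bsub>Pol\<^esub>)"
  using assms(3)
proof (induction rule: Sym.P_induct)
  case (add B s f)
  have "hcomp t (single R A r \<otimes>\<^bsub>Pol\<^esub> single R B s) =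
    (if size A \<le> t then single R A r \<otimes>\<^bsub>Pol\<^esub> hcomp (t - size A) (single R B s) else \<zero>\<^bsub>Pol\<^esub>)"
    using assms add by (auto simp: Sym.single_mult hcomp_single)
  then show ?case
    using assms add by (simp add: Sym.P.r_distr hcomp_add)
qed (use assms in simp)

text \<open>The ideal of relations is generated by polynomials homogeneous of degree 1, hence it
  contains the components of its elements.\<close>

lemma hcomp_SI:
  assumes "f \<in> SI"
  shows "hcomp t f \<in> SI"
proof -
  \<comment> \<open>All degrees are required at once, because multiplying by a monomial relates the
    component in degree t to one in a lower degree.\<close>
  let ?K = "{f \<in> carrier Pol. \<forall>t. hcomp t f \<in> SI}"
  have mult: "p \<otimes>\<^bsub>Pol\<^esub> f \<in> ?K" if "p \<in> carrier Pol" and f: "f \<in> ?K" for p f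
    using that(1)
  proof (induction rule: Sym.P_induct)
    case (add A r p)
    have "single R A r \<otimes>\<^bsub>Pol\<^esub> f \<in> ?K"
      using add f by (auto simp: hcomp_mult_single intro: Sym.L.I_l_closed)
    then show ?case
      using add f by (simp add: Sym.P.l_distr hcomp_add)
  qed (use f in simp)
  have "SI \<subseteq> ?K"
  proof (rule Sym.L_minimal)
    show "ideal ?K Pol"
    proof (rule idealI)
      show "subgroup ?K (add_monoid Pol)"
        by (rule Sym.P.add.subgroupI) (auto simp: hcomp_add intro: exI[of _ "\<zero>\<^bsub>Pol\<^esub>"])
      show "p \<otimes>\<^bsub>Pol\<^esub> f \<in> ?K" if "f \<in> ?K" "p \<in> carrier Pol" for p f
        using that by (intro mult)
      show "f \<otimes>\<^bsub>Pol\<^esub> p \<in> ?K" if "f \<in> ?K" "p \<in> carrier Pol" for p f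
        using mult[OF that(2,1)] that by (simp add: Sym.P.m_comm)
    qed (rule Sym.P.ring_axioms)
  next
    fix x y assume "x \<in> carrier IM" "y \<in> carrier IM"
    then show "single R {#x \<oplus>\<^bsub>IM\<^esub> y#} \<one> \<ominus>\<^bsub>Pol\<^esub> single R {#x#} \<one> \<ominus>\<^bsub>Pol\<^esub> single R {#y#} \<one> \<in> ?K"
      using Sym.L_add[of x y] by (simp add: hcomp.hom_minus hcomp_single Sym.P.minus_eq)
  next
    fix r x assume "r \<in> carrier R" "x \<in> carrier IM"
    then show "single R {#r \<odot>\<^bsub>IM\<^esub> x#} \<one> \<ominus>\<^bsub>Pol\<^esub> single R {#x#} r \<in> ?K"
      using Sym.L_smult[of r x] by (simp add: hcomp.hom_minus hcomp_single I.I_l_closed Sym.P.minus_eq)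
  qed
  from subsetD[OF this assms] show ?thesis by simp
qed

text \<open>A polynomial is a finite sum of its components; \<open>trunc\<close> accumulates them in
  order of degree.\<close>

lemma SI_if_hcomp_SI:
  assumes f: "f \<in> carrier Pol" and hcomp: "\<And>t. hcomp t f \<in> SI"
  shows "f \<in> SI"
proof -
  define trunc where "trunc N = (\<lambda>A. if size A < N then f A else \<zero>)" for N
  have "trunc N \<in> SI" for N
  proof (induction N)
    case 0
    have "trunc 0 = \<zero>\<^bsub>Pol\<^esub>"
      by (auto simp: trunc_def Pol_apply)
    then show ?case by simp
  next
    case (Suc N)
    have "trunc (Suc N) = trunc N \<oplus>\<^bsub>Pol\<^esub> hcomp N f"
      using f by (auto simp: trunc_def hcomp_def Pol_apply Pol_carrier_iff)
    then show ?case
      using Suc hcomp by simp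
  qed
  \<comment> \<open>The \<open>Suc\<close> makes the largest size a strict bound. For f = 0 the
    maximum is over the empty set, which is harmless since every truncation of f is then
    zero.\<close>
  moreover have "f = trunc (Suc (Max (size ` coeff_supp R f)))"
  proof
    fix A
    have "size A \<le> Max (size ` coeff_supp R f)" if "f A \<noteq> \<zero>"
      using f that by (intro Max_ge) (auto simp: Pol_carrier_iff coeff_supp_def)
    then show "f A = trunc (Suc (Max (size ` coeff_supp R f))) A"
      by (cases "f A = \<zero>") (simp_all add: trunc_def less_Suc_eq_le)
  qed
  ultimately show ?thesis by metis
qed

text \<open>A monomial with n variables evaluates to a multiple of u^n, so the degree t part of f
  accounts for exactly the u^t term. In consequence the kernel of evaluation is homogeneous.\<close>

lemma cf_rees_eval_hcomp:
  assumes "f \<in> carrier Pol"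
  shows "cf (rees_eval (hcomp t f)) s = (if s = t then cf (rees_eval f) t else \<zero>)"
proof -
  have closed: "rees_eval f \<in> carrier (UP R)" if "f \<in> carrier Pol" for f
    using alpha.lift.lift_closed[OF that] by (simp add: Rees_carrier_iff)
  show ?thesis
    using assms
  proof (induction rule: Sym.P_induct)
    case (add A r f)
    have "cf (rees_eval (hcomp t (single R A r))) s = (if s = t then cf (rees_eval (single R A r)) t else \<zero>)"
      using add by (auto simp: hcomp_single rees_eval_single simp del: alpha.lift.lift_single)
    then show ?case
      using add closed by (simp add: hcomp_add del: alpha.lift.lift_single)
  qed simp
qed

lemma rees_eval_hcomp_zero:
  assumes "f \<in> carrier Pol" "rees_eval f = \<zero>\<^bsub>UP R\<^esub>"
  shows "rees_eval (hcomp t f) = \<zero>\<^bsub>UP R\<^esub>"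
proof (rule U.up_eqI)
  show "cf (rees_eval (hcomp t f)) n = cf \<zero>\<^bsub>UP R\<^esub> n" for n
    using assms by (simp add: cf_rees_eval_hcomp)
  show "rees_eval (hcomp t f) \<in> carrier (UP R)"
    using alpha.lift.lift_closed[of "hcomp t f"] assms by (simp add: Rees_carrier_iff)
qed simp

section \<open>Trading the factor a for the variable X(a), and the induction on the degree\<close>

text \<open>Both terms equal \<open>X(b x)\<close> in the symmetric algebra.\<close>

lemma swap_factor_SI:
  assumes "x \<in> I" "b \<in> I"
  shows "single R {#x#} b \<ominus>\<^bsub>Pol\<^esub> single R {#b#} x \<in> SI"
proof -
  let ?X = "single R {#b \<otimes> x#} \<one>"
  have "?X \<ominus>\<^bsub>Pol\<^esub> single R {#x#} b \<in> SI" "?X \<ominus>\<^bsub>Pol\<^esub> single R {#b#} x \<in> SI"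
    using Sym.L_smult[of b x] Sym.L_smult[of x b] assms by (auto simp: m_comm)
  then have "(?X \<ominus>\<^bsub>Pol\<^esub> single R {#b#} x) \<ominus>\<^bsub>Pol\<^esub> (?X \<ominus>\<^bsub>Pol\<^esub> single R {#x#} b) \<in> SI"
    by (simp add: Sym.P.minus_eq)
  also have "(?X \<ominus>\<^bsub>Pol\<^esub> single R {#b#} x) \<ominus>\<^bsub>Pol\<^esub> (?X \<ominus>\<^bsub>Pol\<^esub> single R {#x#} b) =
      single R {#x#} b \<ominus>\<^bsub>Pol\<^esub> single R {#b#} x"
  proof -
    have "?X \<in> carrier Pol" "single R {#x#} b \<in> carrier Pol" "single R {#b#} x \<in> carrier Pol"
      using assms by (auto simp: I.I_l_closed)
    then show ?thesis by algebra
  qed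
  finally show ?thesis .
qed

text \<open>In degree t + 1 every monomial contains some variable X(x), and b X(x) agrees with x
  X(b) modulo the relations. So k arises by turning one variable of each monomial into a
  coefficient; \<open>hcomp t k = k\<close> records that it is homogeneous of degree t.\<close>

lemma const_mult_eq_var_mult:
  assumes b: "b \<in> I" and "g \<in> carrier Pol"
  shows "\<exists>k\<in>carrier Pol. hcomp t k = k \<and>
    single R {#} b \<otimes>\<^bsub>Pol\<^esub> hcomp (Suc t) g \<ominus>\<^bsub>Pol\<^esub> single R {#b#} \<one> \<otimes>\<^bsub>Pol\<^esub> k \<in> SI"
  using assms(2)
proof (induction rule: Sym.P_induct)
  case zero
  show ?case
    using b by (intro bexI[of _ "\<zero>\<^bsub>Pol\<^esub>"]) (auto simp: Sym.P.minus_eq)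
next
  case (add A r g)
  let ?b = "single R {#} b" and ?X = "single R {#b#} \<one>"
  have bX: "?b \<in> carrier Pol" "?X \<in> carrier Pol"
    using b by auto
  from add obtain k where k: "k \<in> carrier Pol" "hcomp t k = k"
    "?b \<otimes>\<^bsub>Pol\<^esub> hcomp (Suc t) g \<ominus>\<^bsub>Pol\<^esub> ?X \<otimes>\<^bsub>Pol\<^esub> k \<in> SI" by blast
  obtain k' where k': "k' \<in> carrier Pol" "hcomp t k' = k'"
    "?b \<otimes>\<^bsub>Pol\<^esub> hcomp (Suc t) (single R A r) \<ominus>\<^bsub>Pol\<^esub> ?X \<otimes>\<^bsub>Pol\<^esub> k' \<in> SI"
  proof (cases "size A = Suc t")
    case True
    then obtain x B where A: "A = add_mset x B"
      by (metis size_eq_Suc_imp_eq_union)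
    then have xB: "x \<in> I" "set_mset B \<subseteq> I" "size B = t"
      using add True by auto
    \<comment> \<open>The swapping relation is multiplied by the rest r B of the monomial.\<close>
    have "single R B r \<otimes>\<^bsub>Pol\<^esub> (single R {#x#} b \<ominus>\<^bsub>Pol\<^esub> single R {#b#} x) \<in> SI"
      using xB add b by (intro Sym.L.I_l_closed swap_factor_SI) auto
    also have "single R B r \<otimes>\<^bsub>Pol\<^esub> (single R {#x#} b \<ominus>\<^bsub>Pol\<^esub> single R {#b#} x) =
        single R B r \<otimes>\<^bsub>Pol\<^esub> single R {#x#} b \<ominus>\<^bsub>Pol\<^esub> single R B r \<otimes>\<^bsub>Pol\<^esub> single R {#b#} x"
      using xB add b by (simp add: Sym.P.minus_eq Sym.P.r_distr Sym.P.r_minus)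
    also have "single R B r \<otimes>\<^bsub>Pol\<^esub> single R {#x#} b = ?b \<otimes>\<^bsub>Pol\<^esub> single R A r"
      using xB add b by (simp add: A Sym.single_mult m_comm)
    also have "single R B r \<otimes>\<^bsub>Pol\<^esub> single R {#b#} x = ?X \<otimes>\<^bsub>Pol\<^esub> single R B (r \<otimes> x)"
      using xB add b by (simp add: Sym.single_mult)
    finally show ?thesis
      \<comment> \<open>The variable X(x) has been removed from the monomial and x absorbed into its
        coefficient.\<close>
      using that[of "single R B (r \<otimes> x)"] xB add True by (simp add: hcomp_single)
  next
    case False
    then show ?thesis
      using that[of "\<zero>\<^bsub>Pol\<^esub>"] bX by (simp add: hcomp_single Sym.P.minus_eq)
  qed
  let ?c = "hcomp (Suc t) (single R A r)" and ?d = "hcomp (Suc t) g"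
  have closed: "?c \<in> carrier Pol" "?d \<in> carrier Pol"
    using add by auto
  have "?b \<otimes>\<^bsub>Pol\<^esub> (?c \<oplus>\<^bsub>Pol\<^esub> ?d) \<ominus>\<^bsub>Pol\<^esub> ?X \<otimes>\<^bsub>Pol\<^esub> (k' \<oplus>\<^bsub>Pol\<^esub> k) =
      (?b \<otimes>\<^bsub>Pol\<^esub> ?c \<ominus>\<^bsub>Pol\<^esub> ?X \<otimes>\<^bsub>Pol\<^esub> k') \<oplus>\<^bsub>Pol\<^esub> (?b \<otimes>\<^bsub>Pol\<^esub> ?d \<ominus>\<^bsub>Pol\<^esub> ?X \<otimes>\<^bsub>Pol\<^esub> k)"
    using bX closed k(1) k'(1) by algebra
  also have "\<dots> \<in> SI"
    using k k' by blast
  finally show ?case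
    using k k' by (intro bexI[of _ "k' \<oplus>\<^bsub>Pol\<^esub> k"]) (auto simp: hcomp_add)
qed

text \<open>The coefficient of u^(n+1) in a u p is a times the n-th coefficient of p, so regularity
  of a passes to a u.\<close>

lemma mon_mult_eq_zeroD:
  assumes reg: "regular_element R a" and p: "p \<in> carrier (UP R)" and zero: "mon a 1 \<otimes>\<^bsub>UP R\<^esub> p = \<zero>\<^bsub>UP R\<^esub>"
  shows "p = \<zero>\<^bsub>UP R\<^esub>"
proof (rule U.up_eqI)
  fix n
  have a: "a \<in> carrier R"
    using reg by (simp add: regular_element_def)
  have "a \<otimes> cf p n = (\<Oplus>i\<in>{..Suc n}. if 1 = i then a \<otimes> cf p (Suc n - i) else \<zero>)"
    using a p by (subst finsum_singleton) (auto simp: One_nat_def)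
  also have "\<dots> = (\<Oplus>i\<in>{..Suc n}. cf (mon a 1) i \<otimes> cf p (Suc n - i))"
    using a p by (intro finsum_cong') auto
  also have "\<dots> = cf (mon a 1 \<otimes>\<^bsub>UP R\<^esub> p) (Suc n)"
    using a p by (subst U.coeff_mult) auto
  also have "\<dots> = \<zero>"
    by (simp add: zero)
  finally show "cf p n = cf \<zero>\<^bsub>UP R\<^esub> n"
    using reg p by (simp add: regular_element_def)
qed (use p in auto)

text \<open>The assumption \<open>ker\<close> is the inclusion of the kernel in (a, X(a)), expressed
  by polynomials modulo the relations.\<close>

lemma homogeneous_kernel_in_SI:
  assumes a: "a \<in> I" and reg: "regular_element R a"
    and ker: "\<And>f. f \<in> carrier Pol \<Longrightarrow> rees_eval f = \<zero>\<^bsub>UP R\<^esub> \<Longrightarrow> \<exists>g\<in>carrier Pol. \<exists>h\<in>carrier Pol.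
      f \<ominus>\<^bsub>Pol\<^esub> (single R {#} a \<otimes>\<^bsub>Pol\<^esub> g \<oplus>\<^bsub>Pol\<^esub> single R {#a#} \<one> \<otimes>\<^bsub>Pol\<^esub> h) \<in> SI"
    and f: "f \<in> carrier Pol" "hcomp t f = f" "rees_eval f = \<zero>\<^bsub>UP R\<^esub>"
  shows "f \<in> SI"
  using f
proof (induction t arbitrary: f)
  case 0
  \<comment> \<open>Only the empty multiset has size 0, so f is a constant c; it evaluates to c u^0,
    whose coefficient recovers c.\<close>
  have "f A = single R {#} (f {#}) A" for A
    using fun_cong[OF 0(2), of A] by (auto simp: hcomp_def single_def split: if_splits)
  then have f: "f = single R {#} (f {#})" by blast
  have f0: "f {#} \<in> carrier R"
    using 0(1) by (simp add: Pol_carrier_iff)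
  then have "rees_eval (single R {#} (f {#})) = mon (f {#}) 0"
    by (simp add: rees_eval_single del: alpha.lift.lift_single)
  then have "mon (f {#}) 0 = \<zero>\<^bsub>UP R\<^esub>"
    using f 0(3) by simp
  then have "cf (mon (f {#}) 0) 0 = \<zero>"
    by simp
  then have "f {#} = \<zero>"
    using f0 by simp
  then show ?case
    using f Sym.MA.single_zero[of "{#}"] by simp
next
  case (Suc t)
  let ?b = "single R {#} a" and ?X = "single R {#a#} \<one>"
  have bX: "?b \<in> carrier Pol" "?X \<in> carrier Pol"
    using a by auto
  obtain g h where gh: "g \<in> carrier Pol" "h \<in> carrier Pol"
    "f \<ominus>\<^bsub>Pol\<^esub> (?b \<otimes>\<^bsub>Pol\<^esub> g \<oplus>\<^bsub>Pol\<^esub> ?X \<otimes>\<^bsub>Pol\<^esub> h) \<in> SI"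
    using ker[OF Suc.prems(1,3)] by blast
  obtain k where k: "k \<in> carrier Pol" "hcomp t k = k"
    "?b \<otimes>\<^bsub>Pol\<^esub> hcomp (Suc t) g \<ominus>\<^bsub>Pol\<^esub> ?X \<otimes>\<^bsub>Pol\<^esub> k \<in> SI"
    using const_mult_eq_var_mult[OF a gh(1)] by blast
  \<comment> \<open>The cofactors g and h need not be homogeneous. Taking the degree t + 1 part of
    the relation selects degree t + 1 of g, as a has degree 0, and degree t of h, as X(a) has degree
    1.\<close>
  let ?g = "hcomp (Suc t) g" and ?h = "hcomp t h"
  have closed: "?g \<in> carrier Pol" "?h \<in> carrier Pol"
    using gh by auto
  have "f \<ominus>\<^bsub>Pol\<^esub> (?b \<otimes>\<^bsub>Pol\<^esub> ?g \<oplus>\<^bsub>Pol\<^esub> ?X \<otimes>\<^bsub>Pol\<^esub> ?h) \<in> SI"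
    using hcomp_SI[OF gh(3), of "Suc t"] bX gh Suc.prems a
    by (simp add: hcomp.hom_minus hcomp_add hcomp_mult_single)
  \<comment> \<open>Adding the relation for k cancels the multiple of a and leaves a multiple of
    X(a) alone.\<close>
  then have "(f \<ominus>\<^bsub>Pol\<^esub> (?b \<otimes>\<^bsub>Pol\<^esub> ?g \<oplus>\<^bsub>Pol\<^esub> ?X \<otimes>\<^bsub>Pol\<^esub> ?h)) \<oplus>\<^bsub>Pol\<^esub> (?b \<otimes>\<^bsub>Pol\<^esub> ?g \<ominus>\<^bsub>Pol\<^esub> ?X \<otimes>\<^bsub>Pol\<^esub> k) \<in> SI"
    using k(3) by (rule Sym.L.a_closed)
  also have "(f \<ominus>\<^bsub>Pol\<^esub> (?b \<otimes>\<^bsub>Pol\<^esub> ?g \<oplus>\<^bsub>Pol\<^esub> ?X \<otimes>\<^bsub>Pol\<^esub> ?h)) \<oplus>\<^bsub>Pol\<^esub> (?b \<otimes>\<^bsub>Pol\<^esub> ?g \<ominus>\<^bsub>Pol\<^esub> ?X \<otimes>\<^bsub>Pol\<^esub> k) =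
      f \<ominus>\<^bsub>Pol\<^esub> ?X \<otimes>\<^bsub>Pol\<^esub> (?h \<oplus>\<^bsub>Pol\<^esub> k)"
    using bX closed Suc.prems(1) k(1) by algebra
  finally have d: "f \<ominus>\<^bsub>Pol\<^esub> ?X \<otimes>\<^bsub>Pol\<^esub> (?h \<oplus>\<^bsub>Pol\<^esub> k) \<in> SI" .
  define e where "e = ?h \<oplus>\<^bsub>Pol\<^esub> k"
  have e: "e \<in> carrier Pol" "hcomp t e = e"
    using closed k gh by (auto simp: e_def hcomp_add hcomp_hcomp)
  have alX: "rees_eval ?X = mon a 1"
    using rees_eval_single[of "{#a#}" \<one>] a
    by (simp add: I.Icarr One_nat_def del: alpha.lift.lift_single)
  have Xe: "?X \<otimes>\<^bsub>Pol\<^esub> e \<in> carrier Pol"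
    using bX e by simp
  have "rees_eval f \<ominus>\<^bsub>Rees\<^esub> rees_eval (?X \<otimes>\<^bsub>Pol\<^esub> e) = \<zero>\<^bsub>Rees\<^esub>"
    using alpha.pl_L[OF d] Xe Suc.prems(1) by (simp only: alpha.pl.ring.hom_minus e_def)
  then have "rees_eval f = rees_eval (?X \<otimes>\<^bsub>Pol\<^esub> e)"
    by (rule Rees.minus_eq_zeroD[rotated 2])
       (use Xe Suc.prems(1) in \<open>auto intro!: alpha.lift.lift_closed simp del: alpha.pl.hom_mult\<close>)
  then have "mon a 1 \<otimes>\<^bsub>UP R\<^esub> rees_eval e = \<zero>\<^bsub>UP R\<^esub>"
    using bX e Suc.prems(3) alX by simp
  then have "rees_eval e = \<zero>\<^bsub>UP R\<^esub>"
    by (rule mon_mult_eq_zeroD[OF reg, rotated])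
       (use alpha.lift.lift_closed[OF e(1)] in \<open>simp add: Rees_carrier_iff\<close>)
  then have "e \<in> SI"
    using e by (intro Suc.IH)
  then have "?X \<otimes>\<^bsub>Pol\<^esub> e \<in> SI"
    using bX by (intro Sym.L.I_l_closed)
  with d have "(f \<ominus>\<^bsub>Pol\<^esub> ?X \<otimes>\<^bsub>Pol\<^esub> e) \<oplus>\<^bsub>Pol\<^esub> ?X \<otimes>\<^bsub>Pol\<^esub> e \<in> SI"
    unfolding e_def by (rule Sym.L.a_closed)
  also have "(f \<ominus>\<^bsub>Pol\<^esub> ?X \<otimes>\<^bsub>Pol\<^esub> e) \<oplus>\<^bsub>Pol\<^esub> ?X \<otimes>\<^bsub>Pol\<^esub> e = f"
    using bX e(1) Suc.prems(1) by algebra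
  finally show ?case .
qed

text \<open>Kernel and ideal of relations are both homogeneous, so it is enough to treat each
  component of a kernel element.\<close>

lemma linear_typeI:
  assumes "a \<in> I" "regular_element R a"
    and "\<And>f. f \<in> carrier Pol \<Longrightarrow> rees_eval f = \<zero>\<^bsub>UP R\<^esub> \<Longrightarrow> \<exists>g\<in>carrier Pol. \<exists>h\<in>carrier Pol.
      f \<ominus>\<^bsub>Pol\<^esub> (single R {#} a \<otimes>\<^bsub>Pol\<^esub> g \<oplus>\<^bsub>Pol\<^esub> single R {#a#} \<one> \<otimes>\<^bsub>Pol\<^esub> h) \<in> SI"
  shows "linear_type R I"
  unfolding linear_type_iff
proof (intro ballI impI)
  fix f assume f: "f \<in> carrier Pol" "rees_eval f = \<zero>\<^bsub>UP R\<^esub>"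
  have "hcomp t f \<in> SI" for t
    by (rule homogeneous_kernel_in_SI[OF assms, where t = t])
       (use f in \<open>auto simp: hcomp_hcomp rees_eval_hcomp_zero\<close>)
  with f(1) show "f \<in> SI"
    by (rule SI_if_hcomp_SI)
qed

end

section \<open>The symmetric algebra of a quotient by a principal ideal\<close>

locale cring_ideal_elem = cring_ideal +
  fixes a
  assumes a_in: "a \<in> I"
begin

abbreviation J where "J \<equiv> PIdl a"
abbreviation RJ where "RJ \<equiv> R Quot J"
abbreviation QM where "QM \<equiv> quot_module R I J"
abbreviation SQ where "SQ \<equiv> sym_algebra RJ QM"

sublocale J: ideal "PIdl a" R
  using a_in by (intro cgenideal_ideal) simp

sublocale RJ: cring "R Quot (PIdl a)"
  by (rule J.quotient_is_cring) (rule is_cring)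

lemma QM_simps:
  "carrier QM = (\<lambda>x. J +> x) ` I" "C \<oplus>\<^bsub>QM\<^esub> D = C \<oplus>\<^bsub>RJ\<^esub> D" "C \<odot>\<^bsub>QM\<^esub> D = C \<otimes>\<^bsub>RJ\<^esub> D"
  by (simp_all add: quot_module_def ideal_module_def)

sublocale SQ: symmetric_algebra "R Quot (PIdl a)" "quot_module R I (PIdl a)"
proof (rule symmetric_algebra.intro)
  \<comment> \<open>I/(a) is an ideal of R/(a), so its module axioms are an instance of those for
    ideals.\<close>
  interpret IQ: cring_ideal RJ "(\<lambda>x. J +> x) ` I"
    by (intro cring_ideal.intro RJ.is_cring ring_ideal_imp_quot_ideal J.is_ideal I.is_ideal)
  show "module RJ QM"
    unfolding quot_module_def by (rule IQ.IM_module)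
qed

lemma coset_I: "x \<in> I \<Longrightarrow> J +> x \<in> carrier QM"
  by (simp add: QM_simps)

lemma coset_add: "x \<in> carrier R \<Longrightarrow> y \<in> carrier R \<Longrightarrow> J +> (x \<oplus> y) = (J +> x) \<oplus>\<^bsub>RJ\<^esub> (J +> y)"
  using ring_hom_add[OF J.rcos_ring_hom] .

lemma coset_mult: "x \<in> carrier R \<Longrightarrow> y \<in> carrier R \<Longrightarrow> J +> (x \<otimes> y) = (J +> x) \<otimes>\<^bsub>RJ\<^esub> (J +> y)"
  using ring_hom_mult[OF J.rcos_ring_hom] .

sublocale pi: symmetric_algebra_map R "ideal_module R I" "sym_algebra (R Quot (PIdl a)) (quot_module R I (PIdl a))"
  "\<lambda>r. sym_const (R Quot (PIdl a)) (quot_module R I (PIdl a)) (PIdl a +> r)"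
  "\<lambda>x. sym_gen (R Quot (PIdl a)) (quot_module R I (PIdl a)) (PIdl a +> x)"
proof (intro symmetric_algebra_map.intro Sym.symmetric_algebra_axioms SQ.S.is_cring
    symmetric_algebra_map_axioms.intro)
  show "(\<lambda>r. sym_const RJ QM (J +> r)) \<in> ring_hom R SQ"
    using ring_hom_trans[OF J.rcos_ring_hom SQ.sym_const_hom] by (simp add: comp_def)
next
  fix x assume "x \<in> carrier IM"
  then show "sym_gen RJ QM (J +> x) \<in> carrier SQ"
    by (intro SQ.sym_gen_closed coset_I) simp
next
  fix x y assume "x \<in> carrier IM" "y \<in> carrier IM"
  then show "sym_gen RJ QM (J +> (x \<oplus>\<^bsub>IM\<^esub> y)) = sym_gen RJ QM (J +> x) \<oplus>\<^bsub>SQ\<^esub> sym_gen RJ QM (J +> y)"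
    by (simp add: coset_add I.Icarr SQ.sym_gen_add[symmetric] coset_I QM_simps(2))
next
  fix r x assume "r \<in> carrier R" "x \<in> carrier IM"
  then show "sym_gen RJ QM (J +> (r \<odot>\<^bsub>IM\<^esub> x)) = sym_const RJ QM (J +> r) \<otimes>\<^bsub>SQ\<^esub> sym_gen RJ QM (J +> x)"
    by (simp add: coset_mult I.Icarr SQ.sym_gen_smult[symmetric] coset_I QM_simps(3))
qed

abbreviation quot_eval where
  "quot_eval \<equiv> poly_lift R SQ (\<lambda>r. sym_const RJ QM (J +> r)) (\<lambda>x. sym_gen RJ QM (J +> x))"

section \<open>The kernel of the map between symmetric algebras\<close>

abbreviation pb where "pb \<equiv> single R {#} a"
abbreviation pX where "pX \<equiv> single R {#a#} \<one>"
text \<open>The preimage in the polynomial ring of the ideal (a, X(a)) of the symmetric algebra;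
  \<open>D\<close> is therefore the symmetric algebra modulo (a, X(a)).\<close>

definition Q where "Q = SI <+>\<^bsub>Pol\<^esub> (PIdl\<^bsub>Pol\<^esub> pb <+>\<^bsub>Pol\<^esub> PIdl\<^bsub>Pol\<^esub> pX)"
abbreviation D where "D \<equiv> Pol Quot Q"

lemma pb_closed [simp]: "pb \<in> carrier Pol"
  using a_in by simp

lemma pX_closed [simp]: "pX \<in> carrier Pol"
  using a_in by simp

sublocale Q: ideal Q "sym_poly R (ideal_module R I)"
  unfolding Q_def
  by (intro Sym.P.add_ideals Sym.P.cgenideal_ideal Sym.L_ideal pb_closed pX_closed)

sublocale D: cring "sym_poly R (ideal_module R I) Quot Q"
  by (rule Q.quotient_is_cring) (rule Sym.P.is_cring)

abbreviation qcl where "qcl f \<equiv> Q +>\<^bsub>Pol\<^esub> f"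

lemma Q_iff:
  "f \<in> Q \<longleftrightarrow> (\<exists>l\<in>SI. \<exists>g\<in>carrier Pol. \<exists>h\<in>carrier Pol.
     f = l \<oplus>\<^bsub>Pol\<^esub> (g \<otimes>\<^bsub>Pol\<^esub> pb \<oplus>\<^bsub>Pol\<^esub> h \<otimes>\<^bsub>Pol\<^esub> pX))"
  unfolding Q_def set_add_def' cgenideal_def by blast

lemma Q_memI:
  assumes "l \<in> SI" "g \<in> carrier Pol" "h \<in> carrier Pol"
  shows "l \<oplus>\<^bsub>Pol\<^esub> (g \<otimes>\<^bsub>Pol\<^esub> pb \<oplus>\<^bsub>Pol\<^esub> h \<otimes>\<^bsub>Pol\<^esub> pX) \<in> Q"
  unfolding Q_iff using assms by blast

lemma SI_sub_Q: "SI \<subseteq> Q"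
proof
  fix l assume l: "l \<in> SI"
  show "l \<in> Q"
    using Q_memI[OF l Sym.P.zero_closed Sym.P.zero_closed] Sym.L.Icarr[OF l] by simp
qed

lemma pb_Q: "pb \<in> Q"
  using Q_memI[OF Sym.L.zero_closed Sym.P.one_closed Sym.P.zero_closed] by simp

lemma pX_Q: "pX \<in> Q"
  using Q_memI[OF Sym.L.zero_closed Sym.P.zero_closed Sym.P.one_closed] by simp

lemma qcl_eq_zero: "f \<in> Q \<Longrightarrow> qcl f = \<zero>\<^bsub>D\<^esub>"
  by (simp only: Q.coset_eq_zero_iff[OF Q.Icarr])

abbreviation qc where "qc r \<equiv> qcl (single R {#} r)"
abbreviation qg where "qg x \<equiv> qcl (single R {#x#} \<one>)"

lemma qc_hom: "qc \<in> ring_hom R D"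
  using ring_hom_trans[OF Sym.single_const_hom Q.rcos_ring_hom] by (simp add: comp_def)

lemma qcl_closed: "f \<in> carrier Pol \<Longrightarrow> qcl f \<in> carrier D"
  by (rule Q.FactRing_coset_closed)

lemma qg_closed: "x \<in> I \<Longrightarrow> qg x \<in> carrier D"
  by (rule qcl_closed) simp

lemma qcl_mult: "f \<in> carrier Pol \<Longrightarrow> g \<in> carrier Pol \<Longrightarrow> qcl (f \<otimes>\<^bsub>Pol\<^esub> g) = qcl f \<otimes>\<^bsub>D\<^esub> qcl g"
  by (rule ring_hom_mult[OF Q.rcos_ring_hom])

lemma qcl_add: "f \<in> carrier Pol \<Longrightarrow> g \<in> carrier Pol \<Longrightarrow> qcl (f \<oplus>\<^bsub>Pol\<^esub> g) = qcl f \<oplus>\<^bsub>D\<^esub> qcl g"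
  by (rule ring_hom_add[OF Q.rcos_ring_hom])

lemma qcl_eqI:
  assumes "f \<in> carrier Pol" "g \<in> carrier Pol" "f \<ominus>\<^bsub>Pol\<^esub> g \<in> SI"
  shows "qcl f = qcl g"
  using subsetD[OF SI_sub_Q assms(3)] by (simp only: Q.coset_eq_iff[OF assms(1,2)])

lemma qg_add:
  assumes "x \<in> I" "y \<in> I"
  shows "qg (x \<oplus> y) = qg x \<oplus>\<^bsub>D\<^esub> qg y"
proof -
  let ?x = "single R {#x#} \<one>" and ?y = "single R {#y#} \<one>" and ?xy = "single R {#x \<oplus> y#} \<one>"
  have cl: "?x \<in> carrier Pol" "?y \<in> carrier Pol" "?xy \<in> carrier Pol"
    using assms by simp_all
  have "?xy \<ominus>\<^bsub>Pol\<^esub> ?x \<ominus>\<^bsub>Pol\<^esub> ?y \<in> SI"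
    using Sym.L_add[of x y] assms by (simp only: IM_simps)
  also have "?xy \<ominus>\<^bsub>Pol\<^esub> ?x \<ominus>\<^bsub>Pol\<^esub> ?y = ?xy \<ominus>\<^bsub>Pol\<^esub> (?x \<oplus>\<^bsub>Pol\<^esub> ?y)"
    using cl by algebra
  finally show ?thesis
    using cl by (simp only: qcl_add[symmetric] Sym.P.a_closed qcl_eqI)
qed

lemma qg_smult:
  assumes "r \<in> carrier R" "x \<in> I"
  shows "qg (r \<otimes> x) = qc r \<otimes>\<^bsub>D\<^esub> qg x"
proof -
  have "single R {#r \<otimes> x#} \<one> \<ominus>\<^bsub>Pol\<^esub> single R {#x#} r \<in> SI"
    using Sym.L_smult[of r x] assms by (simp only: IM_simps)
  then have "qg (r \<otimes> x) = qcl (single R {#x#} r)"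
    by (rule qcl_eqI[rotated 2]) (use assms in \<open>simp_all add: I.I_l_closed\<close>)
  also have "single R {#x#} r = single R {#} r \<otimes>\<^bsub>Pol\<^esub> single R {#x#} \<one>"
    using assms by (simp add: Sym.single_mult)
  also have "qcl \<dots> = qc r \<otimes>\<^bsub>D\<^esub> qg x"
    by (rule qcl_mult) (use assms in simp_all)
  finally show ?thesis .
qed

text \<open>If x - y = r a, the relations give X(x) = X(y) + r X(a), and X(a) vanishes modulo
  \<open>Q\<close>. Thus variables of \<open>D\<close> depend only on residue classes in
  I/(a).\<close>

lemma qg_cong:
  assumes "x \<in> I" "y \<in> I" "J +> x = J +> y"
  shows "qg x = qg y"
proof -
  note carr = I.Icarr[OF assms(1)] I.Icarr[OF assms(2)]
  have "x \<ominus> y \<in> J"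
    using assms(3) by (simp only: J.coset_eq_iff[OF carr])
  then obtain r where r: "r \<in> carrier R" "x \<ominus> y = r \<otimes> a"
    unfolding cgenideal_def by blast
  have ra: "r \<otimes> a \<in> I"
    using r a_in by (intro I.I_l_closed)
  have "x = y \<oplus> (x \<ominus> y)"
    using carr by algebra
  then have "qg x = qg (y \<oplus> r \<otimes> a)"
    using r by simp
  also have "\<dots> = qg y \<oplus>\<^bsub>D\<^esub> qg (r \<otimes> a)"
    by (rule qg_add[OF assms(2) ra])
  also have "qg (r \<otimes> a) = qc r \<otimes>\<^bsub>D\<^esub> qg a"
    by (rule qg_smult[OF r(1) a_in])
  also have "qg a = \<zero>\<^bsub>D\<^esub>"
    by (rule qcl_eq_zero[OF pX_Q])
  also have "qc r \<otimes>\<^bsub>D\<^esub> \<zero>\<^bsub>D\<^esub> = \<zero>\<^bsub>D\<^esub>"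
    by (rule D.r_null[OF ring_hom_closed[OF qc_hom r(1)]])
  also have "qg y \<oplus>\<^bsub>D\<^esub> \<zero>\<^bsub>D\<^esub> = qg y"
    by (rule D.r_zero[OF qg_closed[OF assms(2)]])
  finally show ?thesis .
qed

text \<open>The kernel of the surjection of symmetric algebras is found by constructing an inverse of the
  induced map on the quotient by \<open>Q\<close>.\<close>

definition rho_const where "rho_const = (\<lambda>C. the_elem (qc ` C))"
definition rho_gen where "rho_gen C = qg (SOME x. x \<in> I \<and> J +> x = C)"

lemma qc_ring_hom_ring: "ring_hom_ring R D qc"
  by (rule ring_hom_ringI2[OF ring_axioms D.ring_axioms qc_hom])

lemma qc_J:
  assumes "r \<in> J" shows "qc r = \<zero>\<^bsub>D\<^esub>"
proof -
  obtain s where s: "s \<in> carrier R" "r = s \<otimes> a"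
    using assms unfolding cgenideal_def by blast
  then have "single R {#} r = single R {#} s \<otimes>\<^bsub>Pol\<^esub> pb"
    using a_in by (simp add: Sym.single_mult I.Icarr)
  then have "single R {#} r \<in> Q"
    using s Q.I_l_closed[OF pb_Q, of "single R {#} s"] by simp
  then show ?thesis by (rule qcl_eq_zero)
qed

lemma rho_const_coset: "r \<in> carrier R \<Longrightarrow> rho_const (J +> r) = qc r"
  unfolding rho_const_def by (rule the_elem_coset[OF J.is_ideal qc_ring_hom_ring qc_J])

lemma rho_const_hom: "rho_const \<in> ring_hom RJ D"
  unfolding rho_const_def by (rule the_elem_ring_hom[OF J.is_ideal qc_ring_hom_ring qc_J])

text \<open>Independence of the representative picked by \<open>SOME\<close> is
  \<open>qg_cong\<close>.\<close>

lemma rho_gen_coset: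
  assumes "x \<in> I" shows "rho_gen (J +> x) = qg x"
proof -
  let ?y = "SOME y. y \<in> I \<and> J +> y = J +> x"
  have "?y \<in> I \<and> J +> ?y = J +> x"
    by (rule someI[of "\<lambda>y. y \<in> I \<and> J +> y = J +> x" x]) (use assms in simp)
  then show ?thesis
    unfolding rho_gen_def using qg_cong[OF _ assms] by blast
qed

lemma QM_cases:
  assumes "C \<in> carrier QM"
  obtains x where "x \<in> I" "C = J +> x"
  using assms unfolding QM_simps by blast

lemma rho_map: "symmetric_algebra_map RJ QM D rho_const rho_gen"
proof (intro symmetric_algebra_map.intro SQ.symmetric_algebra_axioms D.is_cring
    symmetric_algebra_map_axioms.intro rho_const_hom)
  fix C assume "C \<in> carrier QM"
  then obtain x where "x \<in> I" "C = J +> x"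
    by (rule QM_cases)
  then show "rho_gen C \<in> carrier D"
    by (simp only: rho_gen_coset qg_closed)
next
  fix C C' assume C: "C \<in> carrier QM" and C': "C' \<in> carrier QM"
  obtain x where x: "x \<in> I" "C = J +> x"
    using C by (rule QM_cases)
  obtain y where y: "y \<in> I" "C' = J +> y"
    using C' by (rule QM_cases)
  have "C \<oplus>\<^bsub>QM\<^esub> C' = J +> (x \<oplus> y)"
    by (simp only: QM_simps x y coset_add I.Icarr)
  then show "rho_gen (C \<oplus>\<^bsub>QM\<^esub> C') = rho_gen C \<oplus>\<^bsub>D\<^esub> rho_gen C'"
    using x y by (simp only: rho_gen_coset qg_add I.a_closed)
next
  fix E C assume E: "E \<in> carrier RJ" and C: "C \<in> carrier QM"
  obtain x where x: "x \<in> I" "C = J +> x"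
    using C by (rule QM_cases)
  obtain r where r: "r \<in> carrier R" "E = J +> r"
    using E by (rule J.FactRing_carrier_cases)
  have "E \<odot>\<^bsub>QM\<^esub> C = J +> (r \<otimes> x)"
    by (simp only: QM_simps x r coset_mult I.Icarr)
  then show "rho_gen (E \<odot>\<^bsub>QM\<^esub> C) = rho_const E \<otimes>\<^bsub>D\<^esub> rho_gen C"
    using x r by (simp only: rho_gen_coset rho_const_coset qg_smult I.I_l_closed)
qed

lemma quot_eval_const: "r \<in> carrier R \<Longrightarrow> quot_eval (single R {#} r) = sym_const RJ QM (J +> r)"
  using ring_hom_closed[OF pi.h_hom] by (simp add: pi.pl_single)

lemma quot_eval_var: "x \<in> I \<Longrightarrow> quot_eval (single R {#x#} \<one>) = sym_gen RJ QM (J +> x)"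
  using SQ.sym_gen_closed[OF coset_I, of x] by (simp add: pi.pl_single)

text \<open>Following \<open>quot_eval\<close> by the map into \<open>D\<close> gives the quotient
  map modulo \<open>Q\<close>, since the two agree on constants and variables. Whatever
  \<open>quot_eval\<close> kills is therefore zero modulo \<open>Q\<close>.\<close>

lemma quot_eval_zero_imp_Q:
  assumes f: "f \<in> carrier Pol" and zero: "quot_eval f = \<zero>\<^bsub>SQ\<^esub>"
  shows "f \<in> Q"
proof -
  interpret rho: symmetric_algebra_map RJ QM D rho_const rho_gen
    by (rule rho_map)
  have "(rho.sl \<circ> quot_eval) f = qcl f"
  proof (rule Sym.P_hom_eqI[OF D.ring_axioms _ Q.rcos_ring_hom])
    show "rho.sl \<circ> quot_eval \<in> ring_hom Pol D"
      by (rule ring_hom_trans[OF pi.lift.lift_ring_hom rho.sl_hom])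
  next
    fix r assume r: "r \<in> carrier R"
    then have "rho.sl (sym_const RJ QM (J +> r)) = qc r"
      unfolding sym_const_def by (simp add: rho.pl_single rho_const_coset)
    then show "(rho.sl \<circ> quot_eval) (single R {#} r) = qc r"
      using r by (simp only: o_apply quot_eval_const)
  next
    fix x assume "x \<in> carrier IM"
    then have x: "x \<in> I" by simp
    then have "rho.sl (sym_gen RJ QM (J +> x)) = qg x"
      unfolding sym_gen_def using coset_I[of x] by (simp add: rho.pl_single rho_gen_coset)
    then show "(rho.sl \<circ> quot_eval) (single R {#x#} \<one>) = qg x"
      using x by (simp only: o_apply quot_eval_var)
  qed (rule f)
  moreover have "rho.sl \<zero>\<^bsub>SQ\<^esub> = \<zero>\<^bsub>D\<^esub>"
    by (rule ring_hom_zero[OF rho.sl_hom SQ.S.ring_axioms D.ring_axioms])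
  ultimately have "qcl f = \<zero>\<^bsub>D\<^esub>"
    using zero by (simp only: o_apply)
  then show ?thesis
    using f by (simp only: Q.coset_eq_zero_iff)
qed

section \<open>The Aluffi algebra and the equivalence\<close>

sublocale tp: tensor_product "sym_algebra R (ideal_module R I)" "sym_quot R I (PIdl a)" "rees_algebra R I"
  "sym_to_sym_quot R I (PIdl a)" "sym_to_rees R I"
proof -
  have "sym_to_sym_quot R I J \<in> ring_hom (sym_algebra R IM) (sym_quot R I J)"
    unfolding sym_to_sym_quot_def sym_quot_def by (rule pi.sl_hom)
  moreover have "sym_to_rees R I \<in> ring_hom (sym_algebra R IM) Rees"
    unfolding sym_to_rees_def by (rule alpha.sl_hom)
  ultimately show "tensor_product (sym_algebra R IM) (sym_quot R I J) Rees
      (sym_to_sym_quot R I J) (sym_to_rees R I)"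
    using SQ.S.is_cring
    by (intro tensor_product.intro tensor_product_axioms.intro Sym.S.is_cring Rees_cring)
       (simp_all add: sym_quot_def)
qed

text \<open>Linear type makes the Rees side of the tensor product an isomorphism, so base change
  applies. Conversely, injectivity pushes the kernel of \<open>rees_eval\<close> into
  \<open>Q\<close>, and the description \<open>Q_iff\<close> supplies the cofactors that
  \<open>linear_typeI\<close> asks for.\<close>

lemma linear_type_iff_aluffi:
  assumes reg: "regular_element R a"
  shows "linear_type R I \<longleftrightarrow>
    sym_quot_to_aluffi R I J \<in> ring_iso (sym_quot R I J) (aluffi_algebra R I J)"
proof -
  have map: "sym_quot_to_aluffi R I J = (\<lambda>b. tp.tens b \<one>\<^bsub>Rees\<^esub>)"
    by (simp only: sym_quot_to_aluffi_def fun_eq_iff simp_thms)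
  show ?thesis
  proof
    assume "linear_type R I"
    then interpret tensor_product_iso "sym_algebra R IM" "sym_quot R I J" Rees
      "sym_to_sym_quot R I J" "sym_to_rees R I"
      by unfold_locales (simp only: linear_type_def ring_iso_def mem_Collect_eq)
    show "sym_quot_to_aluffi R I J \<in> ring_iso (sym_quot R I J) (aluffi_algebra R I J)"
      unfolding map aluffi_algebra_def by (rule tens_left_iso)
  next
    assume "sym_quot_to_aluffi R I J \<in> ring_iso (sym_quot R I J) (aluffi_algebra R I J)"
    then have inj: "inj_on (\<lambda>b. tp.tens b \<one>\<^bsub>Rees\<^esub>) (carrier (sym_quot R I J))"
      unfolding map by (auto simp only: ring_iso_def bij_betw_def mem_Collect_eq)
    show "linear_type R I"
    proof (rule linear_typeI[OF a_in reg])
      fix f assume f: "f \<in> carrier Pol" "rees_eval f = \<zero>\<^bsub>UP R\<^esub>"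
      have "sym_to_rees R I (Sym.cls f) = \<zero>\<^bsub>Rees\<^esub>"
        unfolding sym_to_rees_def using f by simp
      \<comment> \<open>The class of f is zero on the Rees side, and the balancing relation carries
        this over to the other factor.\<close>
      then have "sym_to_sym_quot R I J (Sym.cls f) = \<zero>\<^bsub>sym_quot R I J\<^esub>"
        by (rule tp.tens_left_inj_imp_kernel_le[OF inj ring_hom_closed[OF Sym.cls_hom f(1)]])
      then have "quot_eval f = \<zero>\<^bsub>SQ\<^esub>"
        using f(1) unfolding sym_to_sym_quot_def sym_quot_def by simp
      then have "f \<in> Q"
        by (rule quot_eval_zero_imp_Q[OF f(1)])
      then obtain l g h where lgh: "l \<in> SI" "g \<in> carrier Pol" "h \<in> carrier Pol"
        "f = l \<oplus>\<^bsub>Pol\<^esub> (g \<otimes>\<^bsub>Pol\<^esub> pb \<oplus>\<^bsub>Pol\<^esub> h \<otimes>\<^bsub>Pol\<^esub> pX)"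
        by (auto simp only: Q_iff)
      have "f \<ominus>\<^bsub>Pol\<^esub> (pb \<otimes>\<^bsub>Pol\<^esub> g \<oplus>\<^bsub>Pol\<^esub> pX \<otimes>\<^bsub>Pol\<^esub> h) = l"
        unfolding lgh(4) using lgh(2,3) Sym.L.Icarr[OF lgh(1)] pb_closed pX_closed by algebra
      with lgh show "\<exists>g\<in>carrier Pol. \<exists>h\<in>carrier Pol.
          f \<ominus>\<^bsub>Pol\<^esub> (pb \<otimes>\<^bsub>Pol\<^esub> g \<oplus>\<^bsub>Pol\<^esub> pX \<otimes>\<^bsub>Pol\<^esub> h) \<in> SI"
        by metis
    qed
  qed
qed

end

theorem proposition1p4:
  fixes R :: "('a, 'm) ring_scheme" and I :: "'a set" and a :: 'a
  assumes "cring R" and "noetherian_ring R"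
    and "ideal I R"
    and "a \<in> I" and "regular_element R a"
  shows "linear_type R I \<longleftrightarrow>
    sym_quot_to_aluffi R I (PIdl\<^bsub>R\<^esub> a)
      \<in> ring_iso (sym_quot R I (PIdl\<^bsub>R\<^esub> a)) (aluffi_algebra R I (PIdl\<^bsub>R\<^esub> a))"
proof -
  interpret cring_ideal_elem R I a
    using assms by (intro cring_ideal_elem.intro cring_ideal.intro cring_ideal_elem_axioms.intro)
  show ?thesis
    by (rule linear_type_iff_aluffi) fact
qed
end
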